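(* Let $n \geq 1$ and let $f_1, \ldots, f_n$ be $S_{n+1}$-invariant (i.e. symmetric) homogeneous polynomials on $\mathbb{P}^n_{\mathbb{C}}$, of degrees $d_1, \ldots, d_n \geq 1$ respectively, in general position in the sense that the hypersurfaces $V(f_1), \ldots, V(f_n)$ intersect transversely. Then $V(f_1, \ldots, f_n)$ is a finite $S_{n+1}$-set of size $d_1 \cdots d_n$. Moreover, the isomorphism type of the $S_{n+1}$-set $V(f_1, \ldots, f_n)$ depends only on $d_1, \ldots, d_n$: if $g_1, \ldots, g_n$ are also symmetric homogeneous polynomials of degrees $d_1, \ldots, d_n$ respectively such that the hypersurfaces $V(g_1), \ldots, V(g_n)$ intersect transversely, then $V(f_1, \ldots, f_n)$ and $V(g_1, \ldots, g_n)$ are isomorphic as $S_{n+1}$-sets.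
   Context: The symmetric group $S_{n+1}$ acts on $\mathbb{P}^n_{\mathbb{C}}$ by permuting the $n+1$ homogeneous coordinates, and correspondingly on homogeneous polynomials in $n+1$ variables with complex coefficients by permuting the variables. $V(f_1, \ldots, f_n) \subseteq \mathbb{P}^n_{\mathbb{C}}$ is the set of common zeros, on which $S_{n+1}$ acts when the $f_i$ are symmetric. The hypersurfaces $V(f_1), \ldots, V(f_n)$ intersect transversely if every common zero is isolated and simple, i.e. the Jacobian determinant of the (dehomogenized) $f_1, \ldots, f_n$ in an affine chart around each common zero is nonzero there. *)

theory Defs
  imports
    "HOL-Complex_Analysis.Complex_Analysis"
    "HOL-Library.Poly_Mapping"
    "HOL-Algebra.Sym_Groups"
    "HOL-Algebra.Group_Action"
    "Jordan_Normal_Form.Determinant"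
begin

section \<open>Polynomials\<close>

text \<open>A polynomial maps each exponent vector (a finitely supported function from variable
  indices to exponents) to its coefficient. On \<open>P\<^sup>n\<close> the variables are indexed by
  \<open>{1..n+1}\<close>, the set on which \<^term>\<open>sym_group (n + 1)\<close> acts.\<close>

type_synonym mpoly = "(nat \<Rightarrow>\<^sub>0 nat) \<Rightarrow>\<^sub>0 complex"

definition in_vars :: "nat set \<Rightarrow> mpoly \<Rightarrow> bool" where
  "in_vars X f \<longleftrightarrow> (\<forall>m\<in>Poly_Mapping.keys f. Poly_Mapping.keys m \<subseteq> X)"

definition eval_mpoly :: "mpoly \<Rightarrow> (nat \<Rightarrow> complex) \<Rightarrow> complex" where
  "eval_mpoly f x = (\<Sum>m\<in>Poly_Mapping.keys f.
     Poly_Mapping.lookup f m * (\<Prod>i\<in>Poly_Mapping.keys m. x i ^ Poly_Mapping.lookup m i))"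

definition homogeneous :: "nat \<Rightarrow> mpoly \<Rightarrow> bool" where
  "homogeneous d f \<longleftrightarrow>
     (\<forall>m\<in>Poly_Mapping.keys f. (\<Sum>i\<in>Poly_Mapping.keys m. Poly_Mapping.lookup m i) = d)"

text \<open>Since \<^const>\<open>Poly_Mapping.map_key\<close> precomposes, pulling back monomials along \<open>\<sigma>\<close> makes
  this the substitution of the variable \<open>\<sigma> i\<close> for the variable \<open>i\<close>.\<close>

definition permute_vars :: "(nat \<Rightarrow> nat) \<Rightarrow> mpoly \<Rightarrow> mpoly" where
  "permute_vars \<sigma> f = Poly_Mapping.map_key (Poly_Mapping.map_key \<sigma>) f"

definition symmetric_mpoly :: "nat \<Rightarrow> mpoly \<Rightarrow> bool" where
  "symmetric_mpoly n f \<longleftrightarrow> (\<forall>\<sigma>\<in>carrier (sym_group (n + 1)). permute_vars \<sigma> f = f)"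

definition symmetric_forms :: "nat \<Rightarrow> (nat \<Rightarrow> nat) \<Rightarrow> (nat \<Rightarrow> mpoly) \<Rightarrow> bool" where
  "symmetric_forms n d f \<longleftrightarrow>
     (\<forall>i\<in>{1..n}. in_vars {1..n+1} (f i) \<and> homogeneous (d i) (f i) \<and> symmetric_mpoly n (f i))"

section \<open>Complex projective space\<close>

text \<open>Coordinates outside \<open>{1..n+1}\<close> are fixed to \<open>0\<close>, so that these functions are
  exactly the nonzero vectors of \<open>\<complex>\<^sup>n\<^sup>+\<^sup>1\<close>.\<close>

definition hom_coords :: "nat \<Rightarrow> (nat \<Rightarrow> complex) set" where
  "hom_coords n = {x. (\<forall>i. i \<notin> {1..n+1} \<longrightarrow> x i = 0) \<and> (\<exists>i\<in>{1..n+1}. x i \<noteq> 0)}"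

definition proj_rel :: "nat \<Rightarrow> ((nat \<Rightarrow> complex) \<times> (nat \<Rightarrow> complex)) set" where
  "proj_rel n = {(x, y). x \<in> hom_coords n \<and> y \<in> hom_coords n \<and>
     (\<exists>c. c \<noteq> 0 \<and> y = (\<lambda>i. c * x i))}"

definition proj_space :: "nat \<Rightarrow> (nat \<Rightarrow> complex) set set" where
  "proj_space n = hom_coords n // proj_rel n"

definition zero_locus :: "nat \<Rightarrow> (nat \<Rightarrow> mpoly) \<Rightarrow> (nat \<Rightarrow> complex) set set" where
  "zero_locus n f = {P \<in> proj_space n. \<forall>i\<in>{1..n}. \<forall>x\<in>P. eval_mpoly (f i) x = 0}"

section \<open>Transverse intersection\<close>

definition dehomogenize :: "nat \<Rightarrow> mpoly \<Rightarrow> (nat \<Rightarrow> complex) \<Rightarrow> complex" where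
  "dehomogenize k f y = eval_mpoly f (y(k := 1))"

text \<open>Matrix indices start at \<open>0\<close>. Row \<open>i\<close> belongs to the polynomial with index \<open>i + 1\<close>, and the
  columns run in increasing order through the affine coordinates \<open>{1..n+1} - {k}\<close> of the
  chart where the \<open>k\<close>-th homogeneous coordinate is nonzero.\<close>

definition chart_jacobian ::
    "nat \<Rightarrow> (nat \<Rightarrow> mpoly) \<Rightarrow> nat \<Rightarrow> (nat \<Rightarrow> complex) \<Rightarrow> complex mat" where
  "chart_jacobian n f k y = Matrix.mat n n (\<lambda>(i, j).
     let l = insert_index k (j + 1)
     in deriv (\<lambda>t. dehomogenize k (f (i + 1)) (y(l := t))) (y l))"

text \<open>The representative \<open>y\<close> of \<open>P\<close> with \<open>y k = 1\<close> is unique, and its remaining entries are the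
  affine coordinates of \<open>P\<close> in the \<open>k\<close>-th chart.\<close>

definition transverse :: "nat \<Rightarrow> (nat \<Rightarrow> mpoly) \<Rightarrow> bool" where
  "transverse n f \<longleftrightarrow> (\<forall>P\<in>zero_locus n f. \<exists>k\<in>{1..n+1}. \<exists>y\<in>P. y k = 1 \<and>
     Determinant.det (chart_jacobian n f k y) \<noteq> 0)"

section \<open>Actions of the symmetric group\<close>

text \<open>The left action \<open>(\<sigma> \<cdot> x) i = x (\<sigma>\<^sup>-\<^sup>1 i)\<close> on representatives. The restriction to \<open>E\<close> is needed
  because \<^const>\<open>BijGroup\<close> consists of extensional functions.\<close>

definition perm_action ::
    "(nat \<Rightarrow> complex) set set \<Rightarrow> (nat \<Rightarrow> nat) \<Rightarrow> (nat \<Rightarrow> complex) set \<Rightarrow> (nat \<Rightarrow> complex) set" where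
  "perm_action E \<sigma> = (\<lambda>P\<in>E. (\<lambda>x. x \<circ> inv_into UNIV \<sigma>) ` P)"

definition gset_isomorphic ::
    "('g, 'z) monoid_scheme \<Rightarrow> 'a set \<Rightarrow> ('g \<Rightarrow> 'a \<Rightarrow> 'a) \<Rightarrow> 'b set \<Rightarrow> ('g \<Rightarrow> 'b \<Rightarrow> 'b) \<Rightarrow> bool" where
  "gset_isomorphic G E \<phi> F \<psi> \<longleftrightarrow>
     (\<exists>h. bij_betw h E F \<and> (\<forall>g\<in>carrier G. \<forall>x\<in>E. h (\<phi> g x) = \<psi> g (h x)))"

end

theory Submission
  imports Defs
    "HOL-Computational_Algebra.Fundamental_Theorem_Algebra"
    "HOL-Computational_Algebra.Field_as_Ring"
    "HOL-Computational_Algebra.Polynomial_Factorial"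
begin

text \<open>
  Two transverse systems are joined by the linear pencil \<open>(1 - t) f + t g\<close> with complex \<open>t\<close>.
  Degeneracy at \<open>t\<close> means that the forms and the products of the coordinates with the maximal
  minors of the Jacobian have a common projective zero; by elimination theory this happens only for
  finitely many \<open>t\<close>, so the nondegenerate parameters form a connected set. Near a nondegenerate
  parameter, Newton's method and the compactness of projective space match the zeros of nearby
  systems by proximity. A permutation of the coordinates preserves proximity, so this matching
  commutes with the symmetries of the pencil, and by connectedness the zero sets at any two
  nondegenerate parameters are isomorphic. The number of zeros is found by joining \<open>f\<close> with the
  system \<open>x\<^sub>i\<^bsup>d\<^sub>i\<^esup> - x\<^sub>n\<^sub>+\<^sub>1\<^bsup>d\<^sub>i\<^esup>\<close>, which need not be symmetric for this purpose.
\<close>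

section \<open>Pencils of homogeneous forms\<close>

text \<open>The analytic part rests on an exact algebraic identity: \<open>F t x - F t y\<close> is
  a sum of terms \<open>q j t x y * (x j - y j)\<close> with continuous \<open>q\<close>, whose
  diagonal values are the partial derivatives. The same quotients drive Newton's contraction and
  give the degrees of the minors. The chart whose Jacobian determinant is nonzero depends on the
  zero, so degeneracy is tested by \<open>x k * minor k t x\<close> for all \<open>k\<close> at
  once. These products are homogeneous, and once powers have equalized all degrees the condition is
  a projective elimination problem. The parameter is complex because finitely many bad values leave
  the plane connected but could cut a real segment. Zeros have no preferred representative.
  Proximity is therefore measured between vectors of maximum norm one, up to a unimodular factor.
  Symmetry enters only through the set \<open>symmetries\<close> of a pencil, so that one
  continuation argument serves both the symmetric pencils and the count, where only the bijection
  matters.\<close>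

text \<open>Forms of degree \<open>d\<close> in the coordinates \<open>x 1, \<dots>, x m\<close> whose coefficients are polynomials in
  the parameter \<open>t\<close> of a pencil, represented as functions.\<close>

inductive form :: "nat \<Rightarrow> nat \<Rightarrow> (complex \<Rightarrow> (nat \<Rightarrow> complex) \<Rightarrow> complex) \<Rightarrow> bool"
  for m :: nat where
  form_coeff: "form m 0 (\<lambda>t x. poly c t)"
| form_var: "i \<in> {1..m} \<Longrightarrow> form m 1 (\<lambda>t x. x i)"
| form_zero: "form m d (\<lambda>t x. 0)"
| form_add: "form m d F \<Longrightarrow> form m d G \<Longrightarrow> form m d (\<lambda>t x. F t x + G t x)"
| form_mult: "form m d F \<Longrightarrow> form m e G \<Longrightarrow> form m (d + e) (\<lambda>t x. F t x * G t x)"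

lemma form_const: "form m 0 (\<lambda>t x. a)"
  using form_coeff[of m "[:a:]"] by simp

lemma form_cmult: "form m d F \<Longrightarrow> form m d (\<lambda>t x. poly c t * F t x)"
  using form_mult[OF form_coeff, of m d F c] by simp

lemma form_scale: "form m d F \<Longrightarrow> form m d (\<lambda>t x. a * F t x)"
  using form_cmult[of m d F "[:a:]"] by simp

lemma form_uminus: "form m d F \<Longrightarrow> form m d (\<lambda>t x. - F t x)"
  using form_scale[of m d F "-1"] by simp

lemma form_diff: "form m d F \<Longrightarrow> form m d G \<Longrightarrow> form m d (\<lambda>t x. F t x - G t x)"
  using form_add[OF _ form_uminus, of m d F G] by simp

lemma form_sum:
  "(\<And>a. a \<in> A \<Longrightarrow> form m d (F a)) \<Longrightarrow> form m d (\<lambda>t x. \<Sum>a\<in>A. F a t x)"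
  by (induction A rule: infinite_finite_induct) (auto intro: form_zero form_add)

lemma form_prod:
  "(\<And>a. a \<in> A \<Longrightarrow> form m (d a) (F a)) \<Longrightarrow> form m (\<Sum>a\<in>A. d a) (\<lambda>t x. \<Prod>a\<in>A. F a t x)"
  by (induction A rule: infinite_finite_induct) (auto intro: form_const form_mult)

lemma form_power: "form m d F \<Longrightarrow> form m (k * d) (\<lambda>t x. F t x ^ k)"
  using form_prod[of "{..<k}" m "\<lambda>_. d" "\<lambda>_. F"] by simp

lemma form_homogeneous: "form m d F \<Longrightarrow> F t (\<lambda>i. a * x i) = a ^ d * F t x"
  by (induction rule: form.induct) (auto simp: algebra_simps power_add)

lemma form_continuous:
  "form m d F \<Longrightarrow> continuous_on UNIV (\<lambda>p. F (fst p) (snd p))"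
proof (induction rule: form.induct)
  case (form_var i)
  show ?case
    by (rule continuous_on_product_then_coordinatewise) (intro continuous_intros)
qed (auto intro!: continuous_intros)

lemma form_zero_degree: "form m d F \<Longrightarrow> d = 0 \<Longrightarrow> \<exists>c. F = (\<lambda>t x. poly c t)"
proof (induction rule: form.induct)
  case (form_zero d)
  show ?case by (rule exI[of _ 0]) auto
next
  case (form_add d F G)
  then obtain c e where "F = (\<lambda>t x. poly c t)" "G = (\<lambda>t x. poly e t)" by auto
  then show ?case by (intro exI[of _ "c + e"]) auto
next
  case (form_mult d F e G)
  then obtain c e where "F = (\<lambda>t x. poly c t)" "G = (\<lambda>t x. poly e t)" by auto
  then show ?case by (intro exI[of _ "c * e"]) auto
qed auto

text \<open>The homogeneity type of a partial derivative of a form of degree \<open>d\<close>: truncated subtraction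
  would wrongly allow constants when \<open>d = 0\<close>.\<close>

definition form_pred :: "nat \<Rightarrow> nat \<Rightarrow> (complex \<Rightarrow> (nat \<Rightarrow> complex) \<Rightarrow> complex) \<Rightarrow> bool" where
  "form_pred m d F \<longleftrightarrow> (case d of 0 \<Rightarrow> F = (\<lambda>t x. 0) | Suc e \<Rightarrow> form m e F)"

lemma form_pred_add:
  "form_pred m d F \<Longrightarrow> form_pred m d G \<Longrightarrow> form_pred m d (\<lambda>t x. F t x + G t x)"
  by (auto simp: form_pred_def form_add split: nat.splits)

lemma form_pred_mult:
  "form_pred m d F \<Longrightarrow> form m e G \<Longrightarrow> form_pred m (d + e) (\<lambda>t x. F t x * G t x)"
  using form_mult[of m "d - 1" F e G]
  by (auto simp: form_pred_def form_zero split: nat.splits)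

text \<open>An algebraic version of Hadamard's lemma. For products, the difference splits into
  \<open>(F t x - F t y) * G t x + (G t x - G t y) * F t y\<close>. Joint continuity in
  \<open>t\<close>, \<open>x\<close>, \<open>y\<close> is what Newton's estimate needs, and the
  degree on the diagonal is what makes the minors of the Jacobian forms.\<close>

lemma form_difference_quotient:
  assumes "form m d F"
  shows "\<exists>q. (\<forall>j. continuous_on UNIV (\<lambda>p. q j (fst p) (fst (snd p)) (snd (snd p)))) \<and>
    (\<forall>t x y. F t x - F t y = (\<Sum>j=1..m. q j t x y * (x j - y j))) \<and>
    (\<forall>j. form_pred m d (\<lambda>t x. q j t x x))"
  using assms
proof (induction rule: form.induct)
  case (form_coeff c)
  show ?case by (intro exI[of _ "\<lambda>_ _ _ _. 0"]) (auto simp: form_pred_def)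
next
  case (form_var i)
  then show ?case
    by (intro exI[of _ "\<lambda>j t x y. if j = i then 1 else 0"])
       (auto simp: form_pred_def form_const form_zero if_distrib[of "\<lambda>c. c * _"] sum.delta cong: if_cong)
next
  case (form_zero d)
  show ?case
    by (intro exI[of _ "\<lambda>_ _ _ _. 0"]) (auto simp: form_pred_def form.form_zero split: nat.splits)
next
  case (form_add d F G)
  then obtain q r where
    q: "\<And>j. continuous_on UNIV (\<lambda>p. q j (fst p) (fst (snd p)) (snd (snd p)))"
      "\<And>t x y. F t x - F t y = (\<Sum>j=1..m. q j t x y * (x j - y j))"
      "\<And>j. form_pred m d (\<lambda>t x. q j t x x)" and
    r: "\<And>j. continuous_on UNIV (\<lambda>p. r j (fst p) (fst (snd p)) (snd (snd p)))"
      "\<And>t x y. G t x - G t y = (\<Sum>j=1..m. r j t x y * (x j - y j))"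
      "\<And>j. form_pred m d (\<lambda>t x. r j t x x)"
    by auto
  have "F t x + G t x - (F t y + G t y) = (\<Sum>j=1..m. (q j t x y + r j t x y) * (x j - y j))" for t x y
    using q(2)[of t x y] r(2)[of t x y] by (simp only: distrib_right sum.distrib) (simp add: algebra_simps)
  then show ?case
    using q(1,3) r(1,3)
    by (intro exI[of _ "\<lambda>j t x y. q j t x y + r j t x y"])
       (auto intro!: continuous_intros form_pred_add)
next
  case (form_mult d F e G)
  then obtain q r where
    q: "\<And>j. continuous_on UNIV (\<lambda>p. q j (fst p) (fst (snd p)) (snd (snd p)))"
      "\<And>t x y. F t x - F t y = (\<Sum>j=1..m. q j t x y * (x j - y j))"
      "\<And>j. form_pred m d (\<lambda>t x. q j t x x)" and
    r: "\<And>j. continuous_on UNIV (\<lambda>p. r j (fst p) (fst (snd p)) (snd (snd p)))"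
      "\<And>t x y. G t x - G t y = (\<Sum>j=1..m. r j t x y * (x j - y j))"
      "\<And>j. form_pred m e (\<lambda>t x. r j t x x)"
    by auto
  let ?s = "\<lambda>j t x y. q j t x y * G t x + r j t x y * F t y"
  have 1: "F t x * G t x - F t y * G t y = (\<Sum>j=1..m. ?s j t x y * (x j - y j))" for t x y
  proof -
    have "F t x * G t x - F t y * G t y = (F t x - F t y) * G t x + (G t x - G t y) * F t y"
      by (simp add: algebra_simps)
    also have "\<dots> = (\<Sum>j=1..m. ?s j t x y * (x j - y j))"
      unfolding q(2) r(2) sum_distrib_right sum.distrib[symmetric]
      by (intro sum.cong) (auto simp: algebra_simps)
    finally show ?thesis .
  qed
  have cF: "continuous_on UNIV (\<lambda>p::complex \<times> (nat \<Rightarrow> complex) \<times> (nat \<Rightarrow> complex). F (fst p) (snd (snd p)))"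
    by (rule continuous_on_compose2[OF form_continuous[OF form_mult.hyps(1)],
          of UNIV "\<lambda>p. (fst p, snd (snd p))", simplified]) (intro continuous_intros)
  have cG: "continuous_on UNIV (\<lambda>p::complex \<times> (nat \<Rightarrow> complex) \<times> (nat \<Rightarrow> complex). G (fst p) (fst (snd p)))"
    by (rule continuous_on_compose2[OF form_continuous[OF form_mult.hyps(2)],
          of UNIV "\<lambda>p. (fst p, fst (snd p))", simplified]) (intro continuous_intros)
  show ?case
  proof (intro exI[of _ ?s] conjI allI)
    fix j
    show "continuous_on UNIV (\<lambda>p. ?s j (fst p) (fst (snd p)) (snd (snd p)))"
      by (intro continuous_on_add continuous_on_mult q(1) r(1) cF cG)
    show "form_pred m (d + e) (\<lambda>t x. ?s j t x x)"
      using form_pred_add[OF form_pred_mult[OF q(3) form_mult.hyps(2)]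
          form_pred_mult[OF r(3) form_mult.hyps(1), of j, unfolded add.commute[of e]], of j] .
  qed (rule 1)
qed

lemma form_cong:
  assumes "form m d F" "\<And>i. i \<in> {1..m} \<Longrightarrow> x i = y i"
  shows "F t x = F t y"
proof -
  obtain q where "F t x - F t y = (\<Sum>j=1..m. q j t x y * (x j - y j))"
    using form_difference_quotient[OF assms(1)] by blast
  also have "\<dots> = 0" using assms(2) by simp
  finally show ?thesis by simp
qed

section \<open>Expansion in the last variable and determinants of forms\<close>

text \<open>The coefficients are indexed by all natural numbers and vanish beyond \<open>d\<close>,
  so that products become plain Cauchy convolutions and the Sylvester entries need no upper range
  check.\<close>

lemma form_last_variable:
  assumes "form (Suc m) d F"
  shows "\<exists>a. (\<forall>k\<le>d. form m (d - k) (a k)) \<and> (\<forall>k>d. a k = (\<lambda>t x. 0)) \<and>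
     (\<forall>t x. F t x = (\<Sum>k\<le>d. a k t x * x (Suc m) ^ k))"
  using assms
proof (induction rule: form.induct)
  case (form_coeff c)
  show ?case
    by (intro exI[of _ "\<lambda>k. if k = 0 then (\<lambda>t x. poly c t) else (\<lambda>t x. 0)"]) (auto intro: form.intros)
next
  case (form_var i)
  show ?case
  proof (cases "i = Suc m")
    case True
    then show ?thesis
      by (intro exI[of _ "\<lambda>k. if k = 1 then (\<lambda>t x. 1) else (\<lambda>t x. 0)"])
         (auto intro: form.intros form_const)
  next
    case False
    then show ?thesis using form_var
      by (intro exI[of _ "\<lambda>k. if k = 0 then (\<lambda>t x. x i) else (\<lambda>t x. 0)"])
         (auto simp: atMost_Suc form.form_var[simplified] form.form_zero)
  qed
next
  case (form_zero d)
  show ?case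
    by (intro exI[of _ "\<lambda>k t x. 0"]) (auto intro: form.form_zero)
next
  case (form_add d F G)
  then obtain a b where
    a: "\<And>k. k \<le> d \<Longrightarrow> form m (d - k) (a k)" "\<And>k. k > d \<Longrightarrow> a k = (\<lambda>t x. 0)"
      "\<And>t x. F t x = (\<Sum>k\<le>d. a k t x * x (Suc m) ^ k)" and
    b: "\<And>k. k \<le> d \<Longrightarrow> form m (d - k) (b k)" "\<And>k. k > d \<Longrightarrow> b k = (\<lambda>t x. 0)"
      "\<And>t x. G t x = (\<Sum>k\<le>d. b k t x * x (Suc m) ^ k)"
    by auto
  show ?case
  proof (intro exI[of _ "\<lambda>k t x. a k t x + b k t x"] conjI allI impI)
    fix k assume "k \<le> d"
    then show "form m (d - k) (\<lambda>t x. a k t x + b k t x)"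
      by (intro form.form_add a(1) b(1))
  qed (use a(2) b(2) in \<open>simp_all add: a(3) b(3) sum.distrib distrib_right\<close>)
next
  case (form_mult d F e G)
  then obtain a b where
    a: "\<And>k. k \<le> d \<Longrightarrow> form m (d - k) (a k)" "\<And>k. k > d \<Longrightarrow> a k = (\<lambda>t x. 0)"
      "\<And>t x. F t x = (\<Sum>k\<le>d. a k t x * x (Suc m) ^ k)" and
    b: "\<And>k. k \<le> e \<Longrightarrow> form m (e - k) (b k)" "\<And>k. k > e \<Longrightarrow> b k = (\<lambda>t x. 0)"
      "\<And>t x. G t x = (\<Sum>k\<le>e. b k t x * x (Suc m) ^ k)"
    by auto
  let ?c = "\<lambda>k t x. \<Sum>i\<le>k. a i t x * b (k - i) t x"
  have 1: "form m (d + e - k) (?c k)" if "k \<le> d + e" for k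
  proof (rule form_sum)
    fix i assume i: "i \<in> {..k}"
    show "form m (d + e - k) (\<lambda>t x. a i t x * b (k - i) t x)"
    \<comment> \<open>Inside both degree ranges the truncated subtractions are exact and the degrees
      add up. Outside, a factor vanishes, and the zero function is a form of every degree.\<close>
    proof (cases "i \<le> d \<and> k - i \<le> e")
      case True
      then have *: "d + e - k = (d - i) + (e - (k - i))" using i by auto
      show ?thesis unfolding * by (rule form.form_mult) (use a(1) b(1) True in auto)
    next
      case False
      then consider "a i = (\<lambda>t x. 0)" | "b (k - i) = (\<lambda>t x. 0)" using a(2) b(2) by fastforce
      then show ?thesis by cases (simp_all add: form.form_zero)
    qed
  qed
  have 2: "?c k = (\<lambda>t x. 0)" if "k > d + e" for k
  proof (intro ext sum.neutral ballI)
    fix t x i assume "i \<in> {..k}"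
    then have "i > d \<or> k - i > e" using that by auto
    then show "a i t x * b (k - i) t x = 0" using a(2) b(2) by auto
  qed
  have 3: "F t x * G t x = (\<Sum>k\<le>d + e. ?c k t x * x (Suc m) ^ k)" for t x
    unfolding a(3) b(3) 
    by (rule polynomial_product) (use a(2) b(2) in auto)
  show ?case
    using 1 2 3 by (intro exI[of _ ?c]) auto
qed

text \<open>The hypothesis concerns whole Leibniz products instead of entries: in a Sylvester matrix
  the degree varies with row and column, and only the total along a permutation is constant.\<close>

lemma form_det:
  fixes M :: "nat \<Rightarrow> nat \<Rightarrow> complex \<Rightarrow> (nat \<Rightarrow> complex) \<Rightarrow> complex"
  assumes "\<And>p. p permutes {0..<k} \<Longrightarrow> form m d (\<lambda>t x. \<Prod>i = 0..<k. M i (p i) t x)"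
  shows "form m d (\<lambda>t x. Determinant.det (Matrix.mat k k (\<lambda>(i, j). M i j t x)))"
proof -
  have "Determinant.det (Matrix.mat k k (\<lambda>(i, j). M i j t x)) =
      (\<Sum>p | p permutes {0..<k}. signof p * (\<Prod>i = 0..<k. M i (p i) t x))" for t x
  proof -
    have "(\<Prod>i = 0..<k. Matrix.mat k k (\<lambda>(i, j). M i j t x) $$ (i, p i)) = (\<Prod>i = 0..<k. M i (p i) t x)"
      if "p permutes {0..<k}" for p
      using permutes_in_image[OF that] by (intro prod.cong) auto
    then show ?thesis
      by (subst det_def'[where n = k]) (auto intro!: sum.cong)
  qed
  then show ?thesis
    by (auto intro!: form_sum form_scale assms)
qed

section \<open>Elimination\<close>

text \<open>The entries of the Sylvester matrix of two polynomials of the same formal degree \<open>e\<close>, with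
  coefficients in increasing order. If its determinant is a form, it must stay one when the
  leading coefficient of the second polynomial vanishes, hence the formal degree.\<close>

definition sylv :: "nat \<Rightarrow> (nat \<Rightarrow> 'a::zero) \<Rightarrow> (nat \<Rightarrow> 'a) \<Rightarrow> nat \<Rightarrow> nat \<Rightarrow> 'a" where
  "sylv e a b i j =
     (if i < e then if i \<le> j then a (j - i) else 0
      else if i - e \<le> j then b (j - (i - e)) else 0)"

lemma sum_lessThan_double: "(\<Sum>i<2 * e. g i) = (\<Sum>i<e. g i) + (\<Sum>i<e. g (e + i))"
  for g :: "nat \<Rightarrow> 'a::comm_monoid_add"
proof -
  have split: "{..<2 * e} = {..<e} \<union> (+) e ` {..<e}"
  proof (rule Set.set_eqI)
    fix i
    have "i \<in> (+) e ` {..<e} \<longleftrightarrow> e \<le> i \<and> i < 2 * e"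
      by (auto intro!: image_eqI[of i _ "i - e"])
    then show "i \<in> {..<2 * e} \<longleftrightarrow> i \<in> {..<e} \<union> (+) e ` {..<e}" by auto
  qed
  show ?thesis
    unfolding split by (subst sum.union_disjoint) (auto simp: sum.reindex)
qed

text \<open>One row of the Sylvester matrix applied to the vector of powers of \<open>z\<close>: the
  row encodes \<open>z ^ r\<close> times the polynomial, and \<open>r < e\<close> keeps it within
  the \<open>2 * e\<close> columns.\<close>

lemma sum_shifted_coeffs:
  fixes c :: "nat \<Rightarrow> complex"
  assumes "\<And>k. k > e \<Longrightarrow> c k = 0" "r < e"
  shows "(\<Sum>j<2 * e. (if r \<le> j then c (j - r) else 0) * z ^ j) = z ^ r * (\<Sum>k\<le>e. c k * z ^ k)"
proof -
  have "(\<Sum>j<2 * e. (if r \<le> j then c (j - r) else 0) * z ^ j) =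
      (\<Sum>j\<in>(+) r ` {..e}. (if r \<le> j then c (j - r) else 0) * z ^ j)"
  proof (rule sum.mono_neutral_right)
    show "\<forall>j\<in>{..<2 * e} - (+) r ` {..e}. (if r \<le> j then c (j - r) else 0) * z ^ j = 0"
    proof
      fix j assume j: "j \<in> {..<2 * e} - (+) r ` {..e}"
      show "(if r \<le> j then c (j - r) else 0) * z ^ j = 0"
      proof (cases "r \<le> j")
        case True
        then have "j - r > e" using j imageI[of "j - r" "{..e}" "(+) r"] by force
        then show ?thesis using assms(1) by simp
      qed simp
    qed
  qed (use assms(2) in auto)
  also have "\<dots> = z ^ r * (\<Sum>k\<le>e. c k * z ^ k)"
    by (subst sum.reindex) (auto simp: sum_distrib_left power_add mult_ac)
  finally show ?thesis .
qed

text \<open>By the fundamental theorem of algebra, a common divisor without roots is a nonzero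
  constant.\<close>

lemma poly_coprime_if_no_common_root:
  fixes p q :: "complex poly"
  assumes "\<And>z. \<not> (poly p z = 0 \<and> poly q z = 0)" 
  shows "coprime p q"
proof (rule coprimeI)
  fix r assume r: "r dvd p" "r dvd q"
  obtain s t where "p = r * s" "q = r * t"
    using r unfolding dvd_def by blast
  then have nz: "poly r z \<noteq> 0" for z
    using assms[of z] poly_mult[of r s z] poly_mult[of r t z] by fastforce
  have "constant (poly r)"
    using Fundamental_Theorem_Algebra.fundamental_theorem_of_algebra[of r] nz by metis
  then have "degree r = 0" by (simp add: constant_degree)
  moreover have "r \<noteq> 0" using nz by auto
  ultimately show "is_unit r" by (simp add: is_unit_iff_degree)
qed

text \<open>A common root \<open>z\<close> gives the kernel vector of powers of \<open>z\<close>.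
  Conversely, the two halves of a kernel vector of the transpose are the coefficients of polynomials
  \<open>u\<close>, \<open>v\<close> of degree below \<open>e\<close> with
  \<open>u * p + v * q = 0\<close>. If \<open>p\<close> and \<open>q\<close> were coprime,
  \<open>p\<close> would divide \<open>v\<close>, and since \<open>a e \<noteq> 0\<close> gives
  \<open>p\<close> degree exactly \<open>e\<close>, both \<open>v\<close> and \<open>u\<close> would
  vanish. The degree of \<open>q\<close> may drop.\<close>

lemma det_sylv_zero_iff:
  fixes a b :: "nat \<Rightarrow> complex"
  assumes a: "\<And>k. k > e \<Longrightarrow> a k = 0" and b: "\<And>k. k > e \<Longrightarrow> b k = 0" and "a e \<noteq> 0"
  shows "Determinant.det (Matrix.mat (2 * e) (2 * e) (\<lambda>(i, j). sylv e a b i j)) = 0 \<longleftrightarrow>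
    (\<exists>z. (\<Sum>k\<le>e. a k * z ^ k) = 0 \<and> (\<Sum>k\<le>e. b k * z ^ k) = 0)"
    (is "Determinant.det ?S = 0 \<longleftrightarrow> _")
proof
  assume "\<exists>z. (\<Sum>k\<le>e. a k * z ^ k) = 0 \<and> (\<Sum>k\<le>e. b k * z ^ k) = 0"
  then obtain z where z: "(\<Sum>k\<le>e. a k * z ^ k) = 0" "(\<Sum>k\<le>e. b k * z ^ k) = 0" by blast
  have "e > 0" using z(1) assms(3) by (cases e) auto
  let ?v = "Matrix.vec (2 * e) (\<lambda>j. z ^ j)"
  have "?S *\<^sub>v ?v = 0\<^sub>v (2 * e)"
  proof (rule eq_vecI)
    fix i assume i: "i < dim_vec (0\<^sub>v (2 * e) :: complex Matrix.vec)"
    have "(?S *\<^sub>v ?v) $ i = (\<Sum>j<2 * e. sylv e a b i j * z ^ j)"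
      using i by (simp add: scalar_prod_def lessThan_atLeast0)
    also have "\<dots> = 0"
    proof (cases "i < e")
      case True
      then show ?thesis
        using sum_shifted_coeffs[of e a i z] a z(1) by (simp add: sylv_def)
    next
      case False
      then show ?thesis
        using sum_shifted_coeffs[of e b "i - e" z] b z(2) i by (simp add: sylv_def)
    qed
    finally show "(?S *\<^sub>v ?v) $ i = 0\<^sub>v (2 * e) $ i" using i by simp
  qed auto
  \<comment> \<open>Entry \<open>0\<close> exists because \<open>e > 0\<close>, and it equals
    \<open>z ^ 0 = 1\<close> even when \<open>z = 0\<close>.\<close>
  moreover have "?v \<noteq> 0\<^sub>v (2 * e)"
  proof
    assume "?v = 0\<^sub>v (2 * e)"
    then have "?v $ 0 = 0\<^sub>v (2 * e) $ 0" by simp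
    then show False using \<open>e > 0\<close> by simp
  qed
  ultimately show "Determinant.det ?S = 0"
    by (subst det_0_iff_vec_prod_zero[of _ "2 * e"]) (auto intro!: exI[of _ ?v])
next
  assume "Determinant.det ?S = 0"
  then have "Determinant.det (transpose_mat ?S) = 0"
    by (subst det_transpose[of _ "2 * e"]) auto
  then obtain w where w: "w \<in> carrier_vec (2 * e)" "w \<noteq> 0\<^sub>v (2 * e)"
      "transpose_mat ?S *\<^sub>v w = 0\<^sub>v (2 * e)"
    by (subst (asm) det_0_iff_vec_prod_zero[of _ "2 * e"]) auto
  define p where "p = (\<Sum>k\<le>e. monom (a k) k)"
  define q where "q = (\<Sum>k\<le>e. monom (b k) k)"
  define u where "u = (\<Sum>k<e. monom (w $ k) k)"
  define v where "v = (\<Sum>k<e. monom (w $ (e + k)) k)"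
  have cp: "coeff p k = a k" for k
    unfolding p_def coeff_sum using a by (auto simp: sum.delta not_le)
  have cq: "coeff q k = b k" for k
    unfolding q_def coeff_sum using b by (auto simp: sum.delta not_le)
  have cu: "coeff u k = (if k < e then w $ k else 0)" for k
    unfolding u_def coeff_sum by (auto simp: sum.delta)
  have cv: "coeff v k = (if k < e then w $ (e + k) else 0)" for k
    unfolding v_def coeff_sum by (auto simp: sum.delta)
  have dp: "degree p = e"
    using assms(3) a by (intro antisym degree_le le_degree) (auto simp: cp)
  have pz: "poly p z = (\<Sum>k\<le>e. a k * z ^ k)" "poly q z = (\<Sum>k\<le>e. b k * z ^ k)" for z
    by (simp_all add: p_def q_def poly_sum poly_monom)
  have mult: "coeff (f * g) j = (\<Sum>i<e. coeff f i * (if i \<le> j then coeff g (j - i) else 0))"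
    if "\<And>k. k \<ge> e \<Longrightarrow> coeff f k = 0" for f g :: "complex poly" and j
  proof -
    have "coeff (f * g) j = (\<Sum>i\<le>j. coeff f i * (if i \<le> j then coeff g (j - i) else 0))"
      by (simp add: coeff_mult)
    also have "\<dots> = (\<Sum>i\<in>{..j} \<inter> {..<e}. coeff f i * (if i \<le> j then coeff g (j - i) else 0))"
      using that by (intro sum.mono_neutral_right) (auto simp: linorder_not_less[symmetric])
    also have "\<dots> = (\<Sum>i<e. coeff f i * (if i \<le> j then coeff g (j - i) else 0))"
      by (intro sum.mono_neutral_left) auto
    finally show ?thesis .
  qed
  have "u * p + v * q = 0"
  proof (rule poly_eqI)
    fix j
    show "coeff (u * p + v * q) j = coeff 0 j"
    proof (cases "j < 2 * e")
      case True
      have "0 = (transpose_mat ?S *\<^sub>v w) $ j" using w(3) True by simp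
      also have "\<dots> = (\<Sum>i<2 * e. sylv e a b i j * w $ i)"
        using True w(1) by (simp add: scalar_prod_def lessThan_atLeast0)
      also have "\<dots> = (\<Sum>i<e. sylv e a b i j * w $ i) + (\<Sum>i<e. sylv e a b (e + i) j * w $ (e + i))"
        by (rule sum_lessThan_double)
      also have "\<dots> = (\<Sum>i<e. w $ i * (if i \<le> j then a (j - i) else 0)) +
          (\<Sum>i<e. w $ (e + i) * (if i \<le> j then b (j - i) else 0))"
        by (simp add: sylv_def mult.commute cong: if_cong)
      also have "\<dots> = coeff (u * p + v * q) j"
        by (simp add: mult cu cv cp cq cong: if_cong)
      finally show ?thesis by simp
    next
      case False
      then show ?thesis
        by (auto simp: mult cu cv cp cq a b intro!: sum.neutral cong: if_cong)
    qed
  qed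
  show "\<exists>z. (\<Sum>k\<le>e. a k * z ^ k) = 0 \<and> (\<Sum>k\<le>e. b k * z ^ k) = 0"
  proof (rule ccontr)
    assume "\<not> ?thesis"
    then have "coprime p q"
      by (intro poly_coprime_if_no_common_root) (auto simp: pz)
    have uv: "v * q = - u * p" using \<open>u * p + v * q = 0\<close>
      by (simp add: eq_neg_iff_add_eq_0 add.commute)
    have "p dvd v * q" unfolding uv by simp
    then have "p dvd v" using \<open>coprime p q\<close> by (simp add: coprime_dvd_mult_left_iff)
    have "v = 0"
    proof (rule ccontr)
      assume "v \<noteq> 0"
      then have "degree p \<le> degree v" using \<open>p dvd v\<close> by (simp add: dvd_imp_degree_le)
      then have "coeff v (degree v) = 0" using dp by (simp add: cv)
      then show False using \<open>v \<noteq> 0\<close> by simp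
    qed
    then have "u = 0" using uv assms(3) cp[of e] by auto
    have "w = 0\<^sub>v (2 * e)"
    proof (rule eq_vecI)
      fix i assume i: "i < dim_vec (0\<^sub>v (2 * e) :: complex Matrix.vec)"
      show "w $ i = 0\<^sub>v (2 * e) $ i"
      proof (cases "i < e")
        case True
        then show ?thesis using cu[of i] \<open>u = 0\<close> by simp
      next
        case False
        then show ?thesis using cv[of "i - e"] \<open>v = 0\<close> i by (auto split: if_splits)
      qed
    qed (use w(1) in auto)
    then show False using w(2) by simp
  qed
qed

text \<open>A nonzero entry in row \<open>i\<close> and column \<open>j\<close> has degree
  \<open>e + r i - j\<close>, where \<open>r i\<close> is the shift of the row within its block.
  Along any permutation these degrees add up to
  \<open>2 * e * e + e * (e - 1) - e * (2 * e - 1)\<close>, which is \<open>e * e\<close>.\<close>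

lemma form_det_sylv:
  assumes a: "\<And>k. k \<le> e \<Longrightarrow> form m (e - k) (a k)" "\<And>k. k > e \<Longrightarrow> a k = (\<lambda>t x. 0)"
    and b: "\<And>k. k \<le> e \<Longrightarrow> form m (e - k) (b k)" "\<And>k. k > e \<Longrightarrow> b k = (\<lambda>t x. 0)"
  shows "form m (e * e) (\<lambda>t x. Determinant.det
    (Matrix.mat (2 * e) (2 * e) (\<lambda>(i, j). sylv e (\<lambda>k. a k t x) (\<lambda>k. b k t x) i j)))"
proof -
  define M where "M = (\<lambda>i j t x. sylv e (\<lambda>k. a k t x) (\<lambda>k. b k t x) i j)"
  define r where "r = (\<lambda>i. if i < e then i else i - e)"
  have M: "M i j = (\<lambda>t x. 0) \<or> (j \<le> e + r i \<and> form m (e + r i - j) (M i j))" for i j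
  proof -
    define c where "c = (if i < e then a else b)"
    have c: "form m (e - k) (c k)" if "k \<le> e" for k using a b that by (auto simp: c_def)
    have c0: "c k = (\<lambda>t x. 0)" if "k > e" for k using a b that by (auto simp: c_def)
    have Mc: "M i j = (if r i \<le> j then c (j - r i) else (\<lambda>t x. 0))"
      by (auto simp: M_def sylv_def r_def c_def)
    show ?thesis
    proof (cases "r i \<le> j \<and> j - r i \<le> e")
      case True
      moreover from this have "e + r i - j = e - (j - r i)" by auto
      ultimately show ?thesis using c[of "j - r i"] by (auto simp: Mc)
    next
      case False
      then show ?thesis using c0[of "j - r i"] by (auto simp: Mc)
    qed
  qed
  let ?E = "(\<Sum>i<2 * e. e + r i) - (\<Sum>j<2 * e. j)"
  have "form m ?E (\<lambda>t x. Determinant.det (Matrix.mat (2 * e) (2 * e) (\<lambda>(i, j). M i j t x)))"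
  proof (rule form_det)
    fix p assume p: "p permutes {0..<2 * e}"
    show "form m ?E (\<lambda>t x. \<Prod>i = 0..<2 * e. M i (p i) t x)"
    proof (cases "\<exists>i\<in>{0..<2 * e}. M i (p i) = (\<lambda>t x. 0)")
      case True
      then have "(\<lambda>t x. \<Prod>i = 0..<2 * e. M i (p i) t x) = (\<lambda>t x. 0)"
        by (auto simp: fun_eq_iff)
      then show ?thesis by (simp add: form_zero)
    next
      case False
      then have *: "p i \<le> e + r i" "form m (e + r i - p i) (M i (p i))" if "i \<in> {0..<2 * e}" for i
        using M[of i "p i"] that by blast+
      have "(\<Sum>i = 0..<2 * e. e + r i - p i) = (\<Sum>i = 0..<2 * e. e + r i) - (\<Sum>i = 0..<2 * e. p i)"
        using * by (intro sum_subtractf_nat) auto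
      also have "(\<Sum>i = 0..<2 * e. p i) = (\<Sum>j = 0..<2 * e. j)"
        using sum.permute[OF p, of "\<lambda>j. j"] by (simp add: o_def)
      finally have "(\<Sum>i = 0..<2 * e. e + r i - p i) = ?E"
        by (simp add: lessThan_atLeast0)
      then show ?thesis
        using form_prod[of "{0..<2 * e}" m "\<lambda>i. e + r i - p i" "\<lambda>i. M i (p i)"] * by simp
    qed
  qed
  moreover have "?E = e * e"
    by (simp add: sum_lessThan_double sum.distrib r_def)
  ultimately show ?thesis unfolding M_def by simp
qed

text \<open>Elimination of the last variable. Since \<open>(0, \<dots>, 0, 1)\<close> is not a common zero at \<open>t0\<close>, some
  \<open>F j0\<close> has a leading coefficient \<open>c t\<close> in that variable with \<open>c t0 \<noteq> 0\<close>. Its resultants with the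
  combinations \<open>\<Sum>j. s ^ j * F j\<close>, for more values of \<open>s\<close> than can be bad for the finitely many
  roots of \<open>F j0\<close>, vanish simultaneously exactly where a common zero lies above, away from the
  zeros of \<open>c\<close>.\<close>

lemma finite_common_zero_params:
  fixes F :: "nat \<Rightarrow> complex \<Rightarrow> (nat \<Rightarrow> complex) \<Rightarrow> complex"
  assumes "\<And>j. j < r \<Longrightarrow> form m e (F j)"
    and "\<And>x. \<exists>i\<in>{1..m}. x i \<noteq> 0 \<Longrightarrow> \<exists>j<r. F j t0 x \<noteq> 0"
  shows "finite {t. \<exists>x. (\<exists>i\<in>{1..m}. x i \<noteq> 0) \<and> (\<forall>j<r. F j t x = 0)}"
  using assms
proof (induction m arbitrary: e r F)
  case 0
  then show ?case by simp
next
  case (Suc m)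
  define p :: "nat \<Rightarrow> complex" where "p = (\<lambda>i. if i = Suc m then 1 else 0)"
  have "\<exists>i\<in>{1..Suc m}. p i \<noteq> 0" by (auto simp: p_def)
  then obtain j0 where j0: "j0 < r" "F j0 t0 p \<noteq> 0" using Suc.prems(2) by blast
  have "\<forall>j\<in>{..<r}. \<exists>a. (\<forall>k\<le>e. form m (e - k) (a k)) \<and> (\<forall>k>e. a k = (\<lambda>t x. 0)) \<and>
     (\<forall>t x. F j t x = (\<Sum>k\<le>e. a k t x * x (Suc m) ^ k))"
    using form_last_variable[OF Suc.prems(1)] by blast
  from bchoice[OF this] obtain a where a': "\<forall>j\<in>{..<r}. (\<forall>k\<le>e. form m (e - k) (a j k)) \<and>
     (\<forall>k>e. a j k = (\<lambda>t x. 0)) \<and>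
     (\<forall>t x. F j t x = (\<Sum>k\<le>e. a j k t x * x (Suc m) ^ k))" ..
  have a: "\<And>j k. j < r \<Longrightarrow> k \<le> e \<Longrightarrow> form m (e - k) (a j k)"
      "\<And>j k. j < r \<Longrightarrow> k > e \<Longrightarrow> a j k = (\<lambda>t x. 0)"
      "\<And>j t x. j < r \<Longrightarrow> F j t x = (\<Sum>k\<le>e. a j k t x * x (Suc m) ^ k)"
    using a' by blast+
  have at: "F j t (x(Suc m := z)) = (\<Sum>k\<le>e. a j k t x * z ^ k)" if "j < r" for j t x z
  proof -
    have "a j k t (x(Suc m := z)) = a j k t x" if "k \<le> e" for k
      by (rule form_cong[OF a(1)]) (use \<open>j < r\<close> that in auto)
    then show ?thesis using a(3)[OF that] by simp
  qed
  obtain c where c: "a j0 e = (\<lambda>t x. poly c t)"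
    using form_zero_degree[OF a(1)[OF j0(1) order_refl]] by auto
  \<comment> \<open>On the last coordinate axis only the top coefficient survives: for
    \<open>k < e\<close> the coefficient \<open>a j0 k\<close> has positive degree, hence vanishes
    at the origin.\<close>
  have lead: "F j0 t x = poly c t * x (Suc m) ^ e" if "\<And>i. i \<in> {1..m} \<Longrightarrow> x i = 0" for t x
  proof -
    have "a j0 k t x = 0" if "k < e" for k
    proof -
      have fk: "form m (e - k) (a j0 k)" using a(1) j0(1) that by simp
      have "a j0 k t x = a j0 k t (\<lambda>i. 0 * x i)"
        by (rule form_cong[OF fk]) (simp add: \<open>\<And>i. i \<in> {1..m} \<Longrightarrow> x i = 0\<close>)
      also have "\<dots> = 0"
        using form_homogeneous[OF fk, of t 0 x] that by simp
      finally show ?thesis .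
    qed
    then have "(\<Sum>k<e. a j0 k t x * x (Suc m) ^ k) = 0" by simp
    then show ?thesis
      using a(3)[OF j0(1), of t x] by (simp add: lessThan_Suc_atMost[symmetric] c)
  qed
  have ct0: "poly c t0 \<noteq> 0" using lead[of p t0] j0(2) by (auto simp: p_def)
  define b where "b = (\<lambda>s k t x. \<Sum>j<r. of_nat s ^ j * a j k t x)"
  define G where "G = (\<lambda>s t x. Determinant.det (Matrix.mat (2 * e) (2 * e)
     (\<lambda>(i, j). sylv e (\<lambda>k. a j0 k t x) (\<lambda>k. b s k t x) i j)))"
  have b1: "form m (e - k) (b s k)" if "k \<le> e" for s k
    unfolding b_def by (intro form_sum form_scale a(1)) (use that in auto)
  have b2: "b s k = (\<lambda>t x. 0)" if "k > e" for s k
    unfolding b_def using a(2) that by simp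
  have G: "form m (e * e) (G s)" for s
    unfolding G_def by (rule form_det_sylv) (use a(1,2) j0(1) b1 b2 in auto)
  have G0: "G s t x = 0 \<longleftrightarrow>
      (\<exists>z. F j0 t (x(Suc m := z)) = 0 \<and> (\<Sum>j<r. of_nat s ^ j * F j t (x(Suc m := z))) = 0)"
    if "poly c t \<noteq> 0" for s t x
  proof -
    have "(\<Sum>j<r. of_nat s ^ j * F j t (x(Suc m := z))) = (\<Sum>k\<le>e. b s k t x * z ^ k)" for z
    proof -
      have "(\<Sum>j<r. of_nat s ^ j * F j t (x(Suc m := z))) =
          (\<Sum>j<r. \<Sum>k\<le>e. of_nat s ^ j * a j k t x * z ^ k)"
        by (simp add: at sum_distrib_left mult.assoc)
      also have "\<dots> = (\<Sum>k\<le>e. b s k t x * z ^ k)"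
        by (subst sum.swap) (simp add: b_def sum_distrib_right)
      finally show ?thesis .
    qed
    moreover have "G s t x = 0 \<longleftrightarrow>
        (\<exists>z. (\<Sum>k\<le>e. a j0 k t x * z ^ k) = 0 \<and> (\<Sum>k\<le>e. b s k t x * z ^ k) = 0)"
      unfolding G_def by (rule det_sylv_zero_iff) (use a(2) j0(1) b2 c that in auto)
    ultimately show ?thesis using at[OF j0(1)] by simp
  qed
  \<comment> \<open>At the parameter \<open>t0\<close> the polynomial \<open>P\<close> has at most
    \<open>e\<close> roots \<open>z\<close>, and each root excludes at most \<open>r\<close> weights
    \<open>s\<close>. One further weight is therefore good.\<close>
  define N where "N = e * r + 1"
  have *: "\<exists>s<N. G s t0 x \<noteq> 0" if x: "\<exists>i\<in>{1..m}. x i \<noteq> 0" for x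
  proof (rule ccontr)
    assume neg: "\<not> ?thesis"
    define P where "P = (\<Sum>k\<le>e. monom (a j0 k t0 x) k)"
    define H where "H = (\<lambda>z. \<Sum>j<r. monom (F j t0 (x(Suc m := z))) j)"
    have "coeff P e = poly c t0" by (simp add: P_def coeff_sum sum.delta c)
    then have "P \<noteq> 0" using ct0 by auto
    have "degree P \<le> e" unfolding P_def
      by (rule degree_sum_le) (auto intro: order_trans[OF degree_monom_le])
    define Z where "Z = {z. poly P z = 0}"
    have Z: "finite Z" "card Z \<le> e"
      using poly_roots_finite[OF \<open>P \<noteq> 0\<close>] card_poly_roots_bound[OF \<open>P \<noteq> 0\<close>] \<open>degree P \<le> e\<close>
      by (auto simp: Z_def)
    have PZ: "poly P z = F j0 t0 (x(Suc m := z))" for z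
      by (simp add: P_def poly_sum poly_monom at[OF j0(1)])
    have HZ: "poly (H z) u = (\<Sum>j<r. u ^ j * F j t0 (x(Suc m := z)))" for z u
      by (simp add: H_def poly_sum poly_monom mult.commute)
    \<comment> \<open>With \<open>z\<close> fixed, the combination of the forms is a polynomial in
      the weight. It is not zero, because \<open>x(Suc m := z)\<close> still has a nonzero entry and
      so is not a common zero at \<open>t0\<close>.\<close>
    have cardH: "finite {s::nat. poly (H z) (of_nat s) = 0} \<and>
        card {s::nat. poly (H z) (of_nat s) = 0} \<le> r" for z
    proof -
      obtain i where "i \<in> {1..m}" "x i \<noteq> 0" using x by blast
      then have "\<exists>i\<in>{1..Suc m}. (x(Suc m := z)) i \<noteq> 0" by (intro bexI[of _ i]) auto
      then obtain j where "j < r" "F j t0 (x(Suc m := z)) \<noteq> 0" using Suc.prems(2) by blast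
      then have "coeff (H z) j \<noteq> 0" by (simp add: H_def coeff_sum sum.delta)
      then have "H z \<noteq> 0" by auto
      have "degree (H z) \<le> r" unfolding H_def
        by (rule degree_sum_le) (auto intro: order_trans[OF degree_monom_le])
      have fin: "finite {u. poly (H z) u = 0}" using poly_roots_finite[OF \<open>H z \<noteq> 0\<close>] .
      have img: "(of_nat :: nat \<Rightarrow> complex) ` {s. poly (H z) (of_nat s) = 0} \<subseteq> {u. poly (H z) u = 0}"
        by auto
      have inj: "inj_on (of_nat :: nat \<Rightarrow> complex) {s. poly (H z) (of_nat s) = 0}"
        by (auto intro: inj_onI)
      have "card {s::nat. poly (H z) (of_nat s) = 0} \<le> card {u. poly (H z) u = 0}"
        using card_inj_on_le[OF inj img fin] .
      also have "\<dots> \<le> degree (H z)" using card_poly_roots_bound[OF \<open>H z \<noteq> 0\<close>] .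
      finally show ?thesis
        using \<open>degree (H z) \<le> r\<close> inj_on_finite[OF inj img fin] by simp
    qed
    have "{..<N} \<subseteq> (\<Union>z\<in>Z. {s. poly (H z) (of_nat s) = 0})"
    proof
      fix s assume "s \<in> {..<N}"
      then have "G s t0 x = 0" using neg by auto
      then show "s \<in> (\<Union>z\<in>Z. {s. poly (H z) (of_nat s) = 0})"
        using G0[OF ct0] by (auto simp: Z_def PZ HZ)
    qed
    then have "card {..<N} \<le> card (\<Union>z\<in>Z. {s::nat. poly (H z) (of_nat s) = 0})"
      using cardH Z(1) by (intro card_mono) auto
    also have "\<dots> \<le> (\<Sum>z\<in>Z. card {s::nat. poly (H z) (of_nat s) = 0})"
      using Z(1) by (rule card_UN_le)
    also have "\<dots> \<le> card Z * r"
      using cardH sum_bounded_above[of Z "\<lambda>z. card {s::nat. poly (H z) (of_nat s) = 0}" r] by simp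
    also have "\<dots> \<le> e * r" using Z(2) by simp
    finally show False by (simp add: N_def)
  qed
  have fin: "finite {t. \<exists>x. (\<exists>i\<in>{1..m}. x i \<noteq> 0) \<and> (\<forall>s<N. G s t x = 0)}"
    by (rule Suc.IH[OF G *])
  have "{t. \<exists>x. (\<exists>i\<in>{1..Suc m}. x i \<noteq> 0) \<and> (\<forall>j<r. F j t x = 0)} \<subseteq>
     {t. poly c t = 0} \<union> {t. \<exists>x. (\<exists>i\<in>{1..m}. x i \<noteq> 0) \<and> (\<forall>s<N. G s t x = 0)}"
  proof
    fix t assume "t \<in> {t. \<exists>x. (\<exists>i\<in>{1..Suc m}. x i \<noteq> 0) \<and> (\<forall>j<r. F j t x = 0)}"
    then obtain x where x: "\<exists>i\<in>{1..Suc m}. x i \<noteq> 0" "\<And>j. j < r \<Longrightarrow> F j t x = 0" by blast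
    show "t \<in> {t. poly c t = 0} \<union> {t. \<exists>x. (\<exists>i\<in>{1..m}. x i \<noteq> 0) \<and> (\<forall>s<N. G s t x = 0)}"
    proof (cases "poly c t = 0")
      case False
      \<comment> \<open>Forgetting the last coordinate must not produce the zero vector. It could do
        so only on the last axis, where \<open>lead\<close> makes \<open>F j0\<close> nonzero as
        long as \<open>poly c t \<noteq> 0\<close>.\<close>
      have "\<exists>i\<in>{1..m}. x i \<noteq> 0"
      proof (rule ccontr)
        assume neg: "\<not> ?thesis"
        then have "x (Suc m) \<noteq> 0" using x(1) by (auto simp: le_Suc_eq)
        moreover have "poly c t * x (Suc m) ^ e = 0" using lead[of x t] x(2)[OF j0(1)] neg by auto
        ultimately show False using False by simp
      qed
      moreover have "G s t x = 0" for s
        unfolding G0[OF False] using x(2) j0(1) by (intro exI[of _ "x (Suc m)"]) auto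
      ultimately show ?thesis by blast
    qed simp
  qed
  moreover have "c \<noteq> 0" using ct0 by auto
  ultimately show ?case
    using fin poly_roots_finite[of c] by (meson finite_UnI finite_subset)
qed

section \<open>Degenerate parameters\<close>

text \<open>Difference quotients of a form in several variables are not unique, hence the choice. On
  the diagonal they are determined for \<open>j \<in> {1..m}\<close>, by
  \<open>deriv_form\<close>.\<close>

definition quot :: "nat \<Rightarrow> nat \<Rightarrow> (complex \<Rightarrow> (nat \<Rightarrow> complex) \<Rightarrow> complex) \<Rightarrow>
    nat \<Rightarrow> complex \<Rightarrow> (nat \<Rightarrow> complex) \<Rightarrow> (nat \<Rightarrow> complex) \<Rightarrow> complex" where
  "quot m d F = (SOME q.
    (\<forall>j. continuous_on UNIV (\<lambda>p. q j (fst p) (fst (snd p)) (snd (snd p)))) \<and>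
    (\<forall>t x y. F t x - F t y = (\<Sum>j=1..m. q j t x y * (x j - y j))) \<and>
    (\<forall>j. form_pred m d (\<lambda>t x. q j t x x)))"

lemma
  assumes "form m d F"
  shows quot_continuous: "continuous_on UNIV (\<lambda>p. quot m d F j (fst p) (fst (snd p)) (snd (snd p)))"
    and quot_eq: "F t x - F t y = (\<Sum>j=1..m. quot m d F j t x y * (x j - y j))"
    and quot_diagonal: "form_pred m d (\<lambda>t x. quot m d F j t x x)"
  using someI_ex[OF form_difference_quotient[OF assms]] unfolding quot_def by blast+

text \<open>Moving coordinate \<open>j\<close> alone leaves a single term of the quotient identity,
  which is then Caratheodory's characterization of the derivative.\<close>

lemma deriv_form:
  assumes "form m d F" "j \<in> {1..m}"
  shows "deriv (\<lambda>s. F t (x(j := s))) (x j) = quot m d F j t x x"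
proof (rule DERIV_imp_deriv)
  let ?q = "\<lambda>s. quot m d F j t (x(j := s)) x"
  have "continuous_on UNIV (\<lambda>s. (x(j := s)) i)" for i
    by (cases "i = j") auto
  then have "continuous_on UNIV (\<lambda>s. (t, x(j := s), x))"
    by (intro continuous_intros continuous_on_coordinatewise_then_product)
  then have cont: "continuous_on UNIV ?q"
    using continuous_on_compose2[OF quot_continuous[OF assms(1)], of UNIV "\<lambda>s. (t, x(j := s), x)"]
    by simp
  have "F t (x(j := s)) - F t (x(j := x j)) = ?q s * (s - x j)" for s
  proof -
    have "F t (x(j := s)) - F t x = (\<Sum>i=1..m. if i = j then ?q s * (s - x j) else 0)"
      unfolding quot_eq[OF assms(1)] by (intro sum.cong) auto
    then show ?thesis using assms(2) by simp
  qed
  moreover have "isCont ?q (x j)"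
    using cont by (simp add: continuous_on_eq_continuous_at)
  ultimately show "((\<lambda>s. F t (x(j := s))) has_field_derivative quot m d F j t x x) (at (x j))"
    unfolding DERIV_caratheodory_within[of _ _ _ UNIV]
    by (intro exI[of _ ?q]) auto
qed

text \<open>No invariance under permutations is assumed, so that the pencil towards the system of
  differences of powers is an instance as well.\<close>

locale form_family =
  fixes n :: nat and d :: "nat \<Rightarrow> nat" and F :: "nat \<Rightarrow> complex \<Rightarrow> (nat \<Rightarrow> complex) \<Rightarrow> complex"
  assumes form: "i \<in> {1..n} \<Longrightarrow> form (n + 1) (d i) (F i)"
    and degree_pos: "i \<in> {1..n} \<Longrightarrow> d i \<ge> 1"
begin

definition is_zero :: "complex \<Rightarrow> (nat \<Rightarrow> complex) \<Rightarrow> bool" where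
  "is_zero t x \<longleftrightarrow> (\<forall>i\<in>{1..n}. F i t x = 0)"

text \<open>The Jacobian with respect to all \<open>n + 1\<close> homogeneous coordinates, with
  column \<open>k\<close> deleted. Unlike the determinant in a chart it is again a form, which makes
  it accessible to elimination.\<close>

definition minor :: "nat \<Rightarrow> complex \<Rightarrow> (nat \<Rightarrow> complex) \<Rightarrow> complex" where
  "minor k t x = Determinant.det (Matrix.mat n n (\<lambda>(i, j).
     let l = insert_index k (j + 1) in deriv (\<lambda>s. F (i + 1) t (x(l := s))) (x l)))"

text \<open>Both \<open>x k\<close> and \<open>minor k t x\<close> are homogeneous in
  \<open>x\<close>, so the condition does not depend on the representative. For a representative
  with \<open>x k = 1\<close> it is the nonvanishing of the chart Jacobian.\<close>

definition nondegenerate :: "complex \<Rightarrow> bool" where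
  "nondegenerate t \<longleftrightarrow>
     (\<forall>x\<in>hom_coords n. is_zero t x \<longrightarrow> (\<exists>k\<in>{1..n+1}. x k \<noteq> 0 \<and> minor k t x \<noteq> 0))"

abbreviation Q :: "nat \<Rightarrow> nat \<Rightarrow> complex \<Rightarrow> (nat \<Rightarrow> complex) \<Rightarrow> (nat \<Rightarrow> complex) \<Rightarrow> complex" where
  "Q i \<equiv> quot (n + 1) (d i) (F i)"

lemma insert_index_mem: "k \<in> {1..n+1} \<Longrightarrow> j < n \<Longrightarrow> insert_index k (j + 1) \<in> {1..n+1}"
  by (auto simp: insert_index_def)

lemma minor_eq:
  assumes "k \<in> {1..n+1}"
  shows "minor k t x = Determinant.det (Matrix.mat n n (\<lambda>(i, j). Q (i + 1) (insert_index k (j + 1)) t x x))"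
  unfolding minor_def
proof (rule arg_cong[of _ _ Determinant.det], rule eq_matI, goal_cases)
  case (1 i j)
  then show ?case
    using deriv_form[OF form[of "Suc i"] insert_index_mem[OF assms, of j]] by (simp add: Let_def)
qed auto

definition minor_degree :: nat where
  "minor_degree = (\<Sum>i = 0..<n. d (i + 1) - 1)"

text \<open>All entries of row \<open>i\<close> have degree \<open>d (i + 1) - 1\<close>, whatever
  the column, so every Leibniz product has the same degree. The subtraction is exact since all
  degrees are positive.\<close>

lemma form_minor:
  assumes "k \<in> {1..n+1}"
  shows "form (n + 1) minor_degree (minor k)"
proof -
  have "form (n + 1) (d (i + 1) - 1) (\<lambda>t x. Q (i + 1) l t x x)" if "i < n" for i l
    using quot_diagonal[OF form[of "Suc i"], of l] degree_pos[of "Suc i"] that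
    by (auto simp: form_pred_def split: nat.splits)
  then have "form (n + 1) minor_degree (\<lambda>t x. Determinant.det
      (Matrix.mat n n (\<lambda>(i, j). Q (i + 1) (insert_index k (j + 1)) t x x)))"
    unfolding minor_degree_def by (intro form_det form_prod) auto
  then show ?thesis
    by (simp add: minor_eq[OF assms, abs_def] cong: if_cong)
qed

lemma finite_degenerate:
  assumes "nondegenerate t0"
  shows "finite {t. \<not> nondegenerate t}"
proof -
  \<comment> \<open>A common multiple of all \<open>d i\<close> and of
    \<open>minor_degree + 1\<close>, the degree of \<open>x k * minor k t x\<close>. Powers bring
    all these forms to the single degree that elimination requires, and their zeros stay the same
    because the exponents are positive.\<close>
  define L where "L = (\<Prod>i=1..n. d i) * (minor_degree + 1)"
  define G where "G = (\<lambda>j. if j < n then (\<lambda>t x. F (Suc j) t x ^ (L div d (Suc j)))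
     else (\<lambda>t x. (x (Suc (j - n)) * minor (Suc (j - n)) t x) ^ (L div (minor_degree + 1))))"
  have "L > 0" unfolding L_def using degree_pos by (auto intro!: prod_pos simp: Suc_le_eq)
  have dvd: "d i dvd L" if "i \<in> {1..n}" for i
    unfolding L_def using that by (intro dvd_mult2 dvd_prodI) auto
  have pos: "L div d i > 0" if "i \<in> {1..n}" for i
    using dvd[OF that] \<open>L > 0\<close> degree_pos[OF that] by (auto elim!: dvdE)
  have pos': "L div (minor_degree + 1) > 0"
  proof -
    have "L div (minor_degree + 1) = (\<Prod>i=1..n. d i)"
      unfolding L_def by (rule nonzero_mult_div_cancel_right) simp
    then show ?thesis using \<open>L > 0\<close> by (auto simp: L_def)
  qed
  have form_G: "form (n + 1) L (G j)" if "j < 2 * n + 1" for j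
  proof (cases "j < n")
    case True
    then show ?thesis
      using form_power[OF form[of "Suc j"], of "L div d (Suc j)"] dvd[of "Suc j"]
      by (simp add: G_def)
  next
    case False
    then have k: "Suc (j - n) \<in> {1..n+1}" using that by auto
    have "form (n + 1) (L div (minor_degree + 1) * (1 + minor_degree)) (G j)"
      using False form_power[OF form_mult[OF form_var[OF k] form_minor[OF k]]]
      by (simp add: G_def)
    moreover have "L div (minor_degree + 1) * (1 + minor_degree) = L"
      unfolding add.commute[of 1] by (rule dvd_div_mult_self) (simp only: L_def dvd_triv_right)
    ultimately show ?thesis by simp
  qed
  have G0: "(\<forall>j<2 * n + 1. G j t x = 0) \<longleftrightarrow>
      is_zero t x \<and> (\<forall>k\<in>{1..n+1}. x k = 0 \<or> minor k t x = 0)" for t x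
  proof -
    have "(\<forall>j<2 * n + 1. G j t x = 0) \<longleftrightarrow> (\<forall>j<n. G j t x = 0) \<and> (\<forall>k<n + 1. G (n + k) t x = 0)"
    proof safe
      fix j assume *: "\<forall>j<n. G j t x = 0" "\<forall>k<n + 1. G (n + k) t x = 0" "j < 2 * n + 1"
      show "G j t x = 0"
      proof (cases "j < n")
        case False
        then show ?thesis using *(2)[rule_format, of "j - n"] *(3) by simp
      qed (use * in simp)
    qed auto
    also have "(\<forall>j<n. G j t x = 0) \<longleftrightarrow> is_zero t x"
    proof -
      have "(\<forall>j<n. G j t x = 0) \<longleftrightarrow> (\<forall>j<n. F (Suc j) t x = 0)"
        using pos by (auto simp: G_def)
      also have "\<dots> \<longleftrightarrow> (\<forall>i\<in>{1..n}. F i t x = 0)"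
        by (metis (no_types, lifting) One_nat_def Suc_le_eq Suc_pred atLeastAtMost_iff le_add1 plus_1_eq_Suc)
      finally show ?thesis by (simp add: is_zero_def)
    qed
    also have "(\<forall>k<n + 1. G (n + k) t x = 0) \<longleftrightarrow> (\<forall>k\<in>{1..n+1}. x k = 0 \<or> minor k t x = 0)"
    proof -
      have "(\<forall>k<n + 1. G (n + k) t x = 0) \<longleftrightarrow> (\<forall>k<n + 1. x (Suc k) = 0 \<or> minor (Suc k) t x = 0)"
        using pos' by (auto simp: G_def)
      also have "\<dots> \<longleftrightarrow> (\<forall>k\<in>{1..n+1}. x k = 0 \<or> minor k t x = 0)"
        by (metis (no_types, lifting) One_nat_def Suc_le_eq Suc_pred atLeastAtMost_iff le_add1 plus_1_eq_Suc)
      finally show ?thesis .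
    qed
    finally show ?thesis .
  qed
  have "finite {t. \<exists>x. (\<exists>i\<in>{1..n+1}. x i \<noteq> 0) \<and> (\<forall>j<2 * n + 1. G j t x = 0)}"
  proof (rule finite_common_zero_params[OF form_G])
    fix x :: "nat \<Rightarrow> complex"
    assume x: "\<exists>i\<in>{1..n+1}. x i \<noteq> 0"
    \<comment> \<open>Elimination ranges over all functions with a nonzero entry in
      \<open>{1..n+1}\<close>, while \<open>hom_coords\<close> demands zeros elsewhere. The forms do
      not see the difference.\<close>
    define y where "y = (\<lambda>i. if i \<in> {1..n+1} then x i else 0)"
    have "y \<in> hom_coords n" using x by (auto simp: y_def hom_coords_def)
    then have "\<not> (\<forall>j<2 * n + 1. G j t0 y = 0)"
      using assms unfolding nondegenerate_def G0 by blast
    then obtain j where j: "j < 2 * n + 1" "G j t0 y \<noteq> 0" by blast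
    moreover have "G j t0 x = G j t0 y"
      by (rule form_cong[OF form_G[OF j(1)]]) (simp add: y_def)
    ultimately show "\<exists>j<2 * n + 1. G j t0 x \<noteq> 0" by auto
  qed
  then show ?thesis
  proof (rule rev_finite_subset)
    show "{t. \<not> nondegenerate t} \<subseteq> {t. \<exists>x. (\<exists>i\<in>{1..n+1}. x i \<noteq> 0) \<and> (\<forall>j<2 * n + 1. G j t x = 0)}"
      unfolding nondegenerate_def G0 hom_coords_def by blast
  qed
qed

end

section \<open>Newton's method\<close>

text \<open>Tychonoff's theorem.\<close>

lemma compact_coordinatewise:
  fixes S :: "nat \<Rightarrow> 'a::topological_space set"
  assumes "\<And>i. compact (S i)"
  shows "compact {y. \<forall>i. y i \<in> S i}"
proof -
  have "compactin (product_topology (\<lambda>i. euclidean) UNIV) (Pi\<^sub>E UNIV S)"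
    using assms by (subst compactin_PiE) auto
  moreover have "Pi\<^sub>E UNIV S = {y. \<forall>i. y i \<in> S i}"
    by (auto simp: PiE_def Pi_def)
  ultimately show ?thesis
    by (simp add: euclidean_product_topology)
qed

text \<open>A basic open set of the product topology restricts only finitely many coordinates, so
  the least of their radii is positive.\<close>

lemma open_contains_uniform_ball:
  fixes U :: "(nat \<Rightarrow> complex) set"
  assumes "open U" "x \<in> U"
  shows "\<exists>e>0. \<forall>y. (\<forall>i. norm (y i - x i) < e) \<longrightarrow> y \<in> U"
proof -
  have "openin (product_topology (\<lambda>i. euclidean) UNIV) U"
    using assms(1) by (simp add: euclidean_product_topology)
  from product_topology_open_contains_basis[OF this assms(2)]
  obtain X where X: "x \<in> Pi\<^sub>E UNIV X" "\<And>i. open (X i)" "finite {i. X i \<noteq> UNIV}" "Pi\<^sub>E UNIV X \<subseteq> U"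
    by auto
  have "\<exists>e>0. \<forall>z. norm (z - x i) < e \<longrightarrow> z \<in> X i" for i
    using X(1) X(2)[of i] unfolding open_dist by (auto simp: dist_norm)
  then obtain e where e: "\<And>i. e i > 0" "\<And>i z. norm (z - x i) < e i \<Longrightarrow> z \<in> X i" by metis
  define \<delta> where "\<delta> = Min (insert 1 (e ` {i. X i \<noteq> UNIV}))"
  have "\<delta> > 0" using X(3) e(1) by (auto simp: \<delta>_def)
  moreover have "y \<in> U" if y: "\<And>i. norm (y i - x i) < \<delta>" for y
  proof -
    have "y i \<in> X i" for i
    proof (cases "X i = UNIV")
      case False
      then have "\<delta> \<le> e i" using X(3) by (auto simp: \<delta>_def)
      then show ?thesis using e(2) y[of i] by (meson less_le_trans)
    qed simp
    then show ?thesis using X(4) by auto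
  qed
  ultimately show ?thesis by blast
qed

lemma continuous_uniform_ball:
  fixes h :: "complex \<Rightarrow> (nat \<Rightarrow> complex) \<Rightarrow> (nat \<Rightarrow> complex) \<Rightarrow> 'a::metric_space"
  assumes "continuous_on UNIV (\<lambda>p. h (fst p) (fst (snd p)) (snd (snd p)))" "e > 0"
  shows "\<exists>\<delta>>0. \<forall>t x y. dist t t0 < \<delta> \<longrightarrow> (\<forall>i. norm (x i - x0 i) < \<delta>) \<longrightarrow>
    (\<forall>i. norm (y i - y0 i) < \<delta>) \<longrightarrow> dist (h t x y) (h t0 x0 y0) < e"
proof -
  let ?V = "(\<lambda>p. h (fst p) (fst (snd p)) (snd (snd p))) -` ball (h t0 x0 y0) e"
  have "open ?V" using assms(1) by (intro open_vimage) auto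
  moreover have "(t0, x0, y0) \<in> ?V" using assms(2) by simp
  ultimately obtain A B where AB: "open A" "open B" "(t0, x0, y0) \<in> A \<times> B" "A \<times> B \<subseteq> ?V"
    by (rule open_prod_elim)
  from AB(3) have "(x0, y0) \<in> B" by simp
  then obtain C D where CD: "open C" "open D" "(x0, y0) \<in> C \<times> D" "C \<times> D \<subseteq> B"
    using AB(2) by (auto elim: open_prod_elim)
  obtain a where a: "a > 0" "\<And>t. dist t t0 < a \<Longrightarrow> t \<in> A"
    using AB(1,3) unfolding open_dist by auto
  obtain b where b: "b > 0" "\<And>x. (\<And>i. norm (x i - x0 i) < b) \<Longrightarrow> x \<in> C"
    using open_contains_uniform_ball[OF CD(1), of x0] CD(3) by auto
  obtain c where c: "c > 0" "\<And>y. (\<And>i. norm (y i - y0 i) < c) \<Longrightarrow> y \<in> D"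
    using open_contains_uniform_ball[OF CD(2), of y0] CD(3) by auto
  show ?thesis
  proof (intro exI[of _ "min a (min b c)"] conjI allI impI)
    fix t x y
    assume "dist t t0 < min a (min b c)" "\<forall>i. norm (x i - x0 i) < min a (min b c)"
      "\<forall>i. norm (y i - y0 i) < min a (min b c)"
    then have "t \<in> A" "x \<in> C" "y \<in> D" by (auto intro: a b c)
    then have "(t, x, y) \<in> ?V" using AB(4) CD(4) by blast
    then show "dist (h t x y) (h t0 x0 y0) < e" by (simp add: dist_commute)
  qed (use a b c in auto)
qed

text \<open>The Newton map \<open>y \<mapsto> y - B F\<^sub>t(y)\<close> is a contraction near \<open>x0\<close> because \<open>B\<close> inverts the
  Jacobian there. Its fixed point is found by minimizing the displacement \<open>B F\<^sub>t(y)\<close> on a compact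
  box: one more Newton step would halve a nonzero minimum.\<close>

lemma newton_local_zero:
  fixes F :: "'i \<Rightarrow> complex \<Rightarrow> (nat \<Rightarrow> complex) \<Rightarrow> complex"
    and Q :: "'i \<Rightarrow> nat \<Rightarrow> complex \<Rightarrow> (nat \<Rightarrow> complex) \<Rightarrow> (nat \<Rightarrow> complex) \<Rightarrow> complex"
    and B :: "nat \<Rightarrow> 'i \<Rightarrow> complex"
  assumes fin: "finite C" "finite I"
    and F_cont: "\<And>i. i \<in> I \<Longrightarrow> continuous_on UNIV (\<lambda>p. F i (fst p) (snd p))"
    and Q_cont: "\<And>i l. i \<in> I \<Longrightarrow> continuous_on UNIV (\<lambda>p. Q i l (fst p) (fst (snd p)) (snd (snd p)))"
    and Q: "\<And>i t y y'. i \<in> I \<Longrightarrow> (\<And>l. l \<notin> C \<Longrightarrow> y l = y' l) \<Longrightarrow>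
       F i t y - F i t y' = (\<Sum>l\<in>C. Q i l t y y' * (y l - y' l))"
    and BQ: "\<And>l l'. l \<in> C \<Longrightarrow> l' \<in> C \<Longrightarrow>
       (\<Sum>i\<in>I. B l i * Q i l' t0 x0 x0) = (if l = l' then 1 else 0)"
    and QB: "\<And>i i'. i \<in> I \<Longrightarrow> i' \<in> I \<Longrightarrow>
       (\<Sum>l\<in>C. Q i l t0 x0 x0 * B l i') = (if i = i' then 1 else 0)"
    and zero: "\<And>i. i \<in> I \<Longrightarrow> F i t0 x0 = 0"
  shows "\<exists>\<rho>>0.
    (\<forall>t y y'. dist t t0 < \<rho> \<longrightarrow> (\<forall>l. norm (y l - x0 l) < \<rho>) \<longrightarrow> (\<forall>l. norm (y' l - x0 l) < \<rho>) \<longrightarrow>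
      (\<forall>l. l \<notin> C \<longrightarrow> y l = y' l) \<longrightarrow> (\<forall>i\<in>I. F i t y = 0 \<and> F i t y' = 0) \<longrightarrow> y = y') \<and>
    (\<forall>\<eta>>0. \<exists>\<delta>>0. \<forall>t. dist t t0 < \<delta> \<longrightarrow>
      (\<exists>y. (\<forall>l. norm (y l - x0 l) \<le> \<eta>) \<and> (\<forall>l. l \<notin> C \<longrightarrow> y l = x0 l) \<and> (\<forall>i\<in>I. F i t y = 0)))"
proof -
  define w where "w = (\<lambda>t y l. \<Sum>i\<in>I. B l i * F i t y)"
  \<comment> \<open>The matrix \<open>1 - B Q\<close> of difference quotients of the Newton map,
    which vanishes at the centre by \<open>BQ\<close>. The sum \<open>h\<close> of the absolute
    values of its entries bounds the contraction factor, so \<open>h < 1 / 2\<close> yields the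
    factor one half.\<close>
  define E where "E = (\<lambda>l l' t y y'. (if l = l' then 1 else 0) - (\<Sum>i\<in>I. B l i * Q i l' t y y'))"
  define h where "h = (\<lambda>t y y'. \<Sum>l\<in>C. \<Sum>l'\<in>C. norm (E l l' t y y'))"
  have h_cont: "continuous_on UNIV (\<lambda>p. h (fst p) (fst (snd p)) (snd (snd p)))"
    unfolding h_def E_def by (intro continuous_intros Q_cont)
  have h0: "h t0 x0 x0 = 0"
    unfolding h_def E_def by (intro sum.neutral ballI) (simp add: BQ)
  obtain \<rho> where \<rho>: "\<rho> > 0" "\<And>t y y'. dist t t0 < \<rho> \<Longrightarrow> (\<And>l. norm (y l - x0 l) < \<rho>) \<Longrightarrow>
      (\<And>l. norm (y' l - x0 l) < \<rho>) \<Longrightarrow> h t y y' < 1 / 2"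
  proof -
    obtain \<rho> where "\<rho> > 0" "\<forall>t x y. dist t t0 < \<rho> \<longrightarrow> (\<forall>i. norm (x i - x0 i) < \<rho>) \<longrightarrow>
        (\<forall>i. norm (y i - x0 i) < \<rho>) \<longrightarrow> dist (h t x y) (h t0 x0 x0) < 1 / 2"
      using continuous_uniform_ball[OF h_cont, of "1/2" t0 x0 x0] by auto
    moreover from this have "h t y y' < 1 / 2" if "dist t t0 < \<rho>" "\<And>l. norm (y l - x0 l) < \<rho>"
        "\<And>l. norm (y' l - x0 l) < \<rho>" for t y y'
    proof -
      have "dist (h t y y') (h t0 x0 x0) < 1 / 2" using calculation that by blast
      then show ?thesis using h0 by (simp add: dist_real_def)
    qed
    ultimately show ?thesis using that by blast
  qed
  have step: "(y l - w t y l) - (y' l - w t y' l) = (\<Sum>l'\<in>C. E l l' t y y' * (y l' - y' l'))"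
    if "l \<in> C" "\<And>l. l \<notin> C \<Longrightarrow> y l = y' l" for l t y y'
  proof -
    have "w t y l - w t y' l = (\<Sum>i\<in>I. B l i * (F i t y - F i t y'))"
      by (simp add: w_def sum_subtractf algebra_simps)
    also have "\<dots> = (\<Sum>i\<in>I. \<Sum>l'\<in>C. B l i * Q i l' t y y' * (y l' - y' l'))"
      using that(2) by (simp add: Q sum_distrib_left mult.assoc)
    also have "\<dots> = (\<Sum>l'\<in>C. (\<Sum>i\<in>I. B l i * Q i l' t y y') * (y l' - y' l'))"
      by (subst sum.swap) (simp add: sum_distrib_right)
    finally have A: "w t y l - w t y' l = (\<Sum>l'\<in>C. (\<Sum>i\<in>I. B l i * Q i l' t y y') * (y l' - y' l'))" .
    have D: "y l - y' l = (\<Sum>l'\<in>C. (if l = l' then 1 else 0) * (y l' - y' l'))"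
      using that(1) fin(1) by (simp add: if_distrib[of "\<lambda>c. c * _"] sum.delta cong: if_cong)
    have "(y l - w t y l) - (y' l - w t y' l) = (y l - y' l) - (w t y l - w t y' l)" by simp
    also have "\<dots> = (\<Sum>l'\<in>C. (if l = l' then 1 else 0) * (y l' - y' l')) -
        (\<Sum>l'\<in>C. (\<Sum>i\<in>I. B l i * Q i l' t y y') * (y l' - y' l'))"
      by (rule arg_cong2[OF D A, of "(-)"])
    also have "\<dots> = (\<Sum>l'\<in>C. E l l' t y y' * (y l' - y' l'))"
      by (simp add: E_def left_diff_distrib sum_subtractf)
    finally show ?thesis .
  qed
  have contract: "(\<Sum>l\<in>C. norm ((y l - w t y l) - (y' l - w t y' l))) \<le> M / 2"
    if t: "dist t t0 < \<rho>" and y: "\<And>l. norm (y l - x0 l) < \<rho>" "\<And>l. norm (y' l - x0 l) < \<rho>"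
      and eq: "\<And>l. l \<notin> C \<Longrightarrow> y l = y' l" and M: "\<And>l. l \<in> C \<Longrightarrow> norm (y l - y' l) \<le> M" "M \<ge> 0"
    for t y y' M
  proof -
    have "(\<Sum>l\<in>C. norm ((y l - w t y l) - (y' l - w t y' l))) =
        (\<Sum>l\<in>C. norm (\<Sum>l'\<in>C. E l l' t y y' * (y l' - y' l')))"
      by (intro sum.cong refl arg_cong[where f = norm] step eq)
    also have "\<dots> \<le> (\<Sum>l\<in>C. \<Sum>l'\<in>C. norm (E l l' t y y') * M)"
      by (intro sum_mono sum_norm_le) (auto simp: norm_mult intro!: mult_left_mono M)
    also have "\<dots> = h t y y' * M"
      by (simp add: h_def sum_distrib_right)
    also have "\<dots> \<le> 1 / 2 * M"
      using \<rho>(2)[OF t y] M(2) by (intro mult_right_mono) auto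
    finally show ?thesis by simp
  qed
  \<comment> \<open>Two zeros are fixed by the Newton map, so their distance is at most half of
    itself.\<close>
  have unique: "y = y'"
    if t: "dist t t0 < \<rho>" and y: "\<And>l. norm (y l - x0 l) < \<rho>" "\<And>l. norm (y' l - x0 l) < \<rho>"
      and eq: "\<And>l. l \<notin> C \<Longrightarrow> y l = y' l" and z: "\<And>i. i \<in> I \<Longrightarrow> F i t y = 0 \<and> F i t y' = 0"
    for t y y'
  proof -
    let ?M = "\<Sum>l\<in>C. norm (y l - y' l)"
    have "w t y l = 0" "w t y' l = 0" for l using z by (simp_all add: w_def)
    moreover have "norm (y l - y' l) \<le> ?M" if "l \<in> C" for l
      using fin(1) that member_le_sum[of l C "\<lambda>l. norm (y l - y' l)"] by simp
    ultimately have "?M \<le> ?M / 2"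
      using contract[OF t y eq, of ?M] by (simp add: sum_nonneg)
    moreover have "?M \<ge> 0" by (simp add: sum_nonneg)
    ultimately have "?M = 0" by linarith
    then have "\<forall>l\<in>C. norm (y l - y' l) = 0"
      using fin(1) by (subst (asm) sum_nonneg_eq_0_iff) auto
    then show ?thesis using eq by (intro ext) (metis eq_iff_diff_eq_0 norm_eq_zero)
  qed
  have exist: "\<exists>\<delta>>0. \<forall>t. dist t t0 < \<delta> \<longrightarrow>
      (\<exists>y. (\<forall>l. norm (y l - x0 l) \<le> \<eta>) \<and> (\<forall>l. l \<notin> C \<longrightarrow> y l = x0 l) \<and> (\<forall>i\<in>I. F i t y = 0))"
    if \<eta>: "0 < \<eta>" "\<eta> < \<rho>" for \<eta>
  proof -
    define g where "g = (\<lambda>t (x :: nat \<Rightarrow> complex) (y :: nat \<Rightarrow> complex). \<Sum>l\<in>C. norm (w t x l))"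
    have F_cont': "continuous_on UNIV (\<lambda>p::complex \<times> (nat \<Rightarrow> complex) \<times> (nat \<Rightarrow> complex). F i (fst p) (fst (snd p)))"
      if "i \<in> I" for i
      by (rule continuous_on_compose2[OF F_cont[OF that], of UNIV "\<lambda>p. (fst p, fst (snd p))", simplified])
         (intro continuous_intros)
    have g_cont: "continuous_on UNIV (\<lambda>p. g (fst p) (fst (snd p)) (snd (snd p)))"
      unfolding g_def w_def by (intro continuous_intros F_cont')
    have g0: "g t0 x0 x0 = 0" by (simp add: g_def w_def zero)
    obtain \<delta> where \<delta>: "\<delta> > 0" "\<And>t. dist t t0 < \<delta> \<Longrightarrow> g t x0 x0 < \<eta> / 2"
    proof -
      obtain \<delta> where "\<delta> > 0" "\<forall>t x y. dist t t0 < \<delta> \<longrightarrow> (\<forall>i. norm (x i - x0 i) < \<delta>) \<longrightarrow>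
          (\<forall>i. norm (y i - x0 i) < \<delta>) \<longrightarrow> dist (g t x y) (g t0 x0 x0) < \<eta> / 2"
        using continuous_uniform_ball[OF g_cont, of "\<eta>/2" t0 x0 x0] \<eta> by auto
      moreover from this have "g t x0 x0 < \<eta> / 2" if "dist t t0 < \<delta>" for t
        using that g0 by (auto simp: dist_norm dest!: spec[of _ t] spec[of _ x0])
      ultimately show ?thesis using that by blast
    qed
    show ?thesis
    proof (intro exI[of _ "min \<delta> \<rho>"] conjI allI impI)
      fix t assume "dist t t0 < min \<delta> \<rho>"
      then have t: "dist t t0 < \<delta>" "dist t t0 < \<rho>" by auto
      define K where "K = {y. \<forall>l. y l \<in> (if l \<in> C then cball (x0 l) \<eta> else {x0 l})}"
      have K: "(y \<in> K) \<longleftrightarrow> (\<forall>l\<in>C. norm (y l - x0 l) \<le> \<eta>) \<and> (\<forall>l. l \<notin> C \<longrightarrow> y l = x0 l)" for y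
        by (auto simp: K_def dist_norm norm_minus_commute split: if_splits)
      have K': "norm (y l - x0 l) < \<rho>" "norm (y l - x0 l) \<le> \<eta>" if "y \<in> K" for y l
        using that \<eta> \<rho>(1) by (cases "l \<in> C"; force simp: K)+
      have "compact K" unfolding K_def by (rule compact_coordinatewise) auto
      have x0K: "x0 \<in> K" using \<eta> by (simp add: K)
      have Ft: "continuous_on K (\<lambda>y. F i t y)" if "i \<in> I" for i
        by (rule continuous_on_compose2[OF F_cont[OF that], of K "\<lambda>y. (t, y)", simplified])
           (intro continuous_intros)
      have "continuous_on K (\<lambda>y. \<Sum>l\<in>C. norm (w t y l))"
        unfolding w_def by (intro continuous_intros Ft)
      from continuous_attains_inf[OF \<open>compact K\<close> _ this] x0K
      obtain y where y: "y \<in> K" "\<And>y'. y' \<in> K \<Longrightarrow> (\<Sum>l\<in>C. norm (w t y l)) \<le> (\<Sum>l\<in>C. norm (w t y' l))"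
        by auto
      define y' where "y' = (\<lambda>l. if l \<in> C then y l - w t y l else x0 l)"
      \<comment> \<open>The step keeps the box: the images of \<open>y\<close> and \<open>x0\<close>
        differ by at most \<open>\<eta> / 2\<close> by contraction, and the image of
        \<open>x0\<close> is within \<open>\<eta> / 2\<close> of \<open>x0\<close> by the choice of
        \<open>\<delta>\<close>.\<close>
      have "y' \<in> K" unfolding K
      proof (intro conjI ballI allI impI)
        fix l assume l: "l \<in> C"
        have "y' l - x0 l = ((y l - w t y l) - (x0 l - w t x0 l)) - w t x0 l"
          using l by (simp add: y'_def)
        then have "norm (y' l - x0 l) \<le> norm ((y l - w t y l) - (x0 l - w t x0 l)) + norm (w t x0 l)"
          by (metis norm_triangle_ineq4)
        also have "norm ((y l - w t y l) - (x0 l - w t x0 l)) \<le>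
            (\<Sum>l\<in>C. norm ((y l - w t y l) - (x0 l - w t x0 l)))"
          using fin(1) l member_le_sum[of l C "\<lambda>l. norm ((y l - w t y l) - (x0 l - w t x0 l))"] by simp
        also have "\<dots> \<le> \<eta> / 2"
          using y(1) K'[OF y(1)] \<rho>(1) \<eta> by (intro contract t) (auto simp: K)
        also have "norm (w t x0 l) \<le> g t x0 x0"
          using fin(1) l member_le_sum[of l C "\<lambda>l. norm (w t x0 l)"] by (simp add: g_def)
        also have "g t x0 x0 \<le> \<eta> / 2" using \<delta>(2)[OF t(1)] by simp
        finally show "norm (y' l - x0 l) \<le> \<eta>" by simp
      qed (simp add: y'_def)
      let ?M = "\<Sum>l\<in>C. norm (w t y l)"
      have diff: "norm (y l - y' l) \<le> ?M" if "l \<in> C" for l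
        using fin(1) that member_le_sum[of l C "\<lambda>l. norm (w t y l)"] by (simp add: y'_def)
      have "?M \<le> (\<Sum>l\<in>C. norm (w t y' l))" by (rule y(2)) fact
      \<comment> \<open>Since \<open>y'\<close> is the Newton image of \<open>y\<close> on
        \<open>C\<close>, the displacement at \<open>y'\<close> is the difference of the Newton
        images of \<open>y\<close> and \<open>y'\<close>.\<close>
      also have "\<dots> = (\<Sum>l\<in>C. norm ((y l - w t y l) - (y' l - w t y' l)))"
        by (intro sum.cong) (auto simp: y'_def)
      also have "\<dots> \<le> ?M / 2"
        using diff K'[OF y(1)] K'[OF \<open>y' \<in> K\<close>] y(1)
        by (intro contract t) (auto simp: K y'_def sum_nonneg)
      finally have "?M \<le> ?M / 2" .
      moreover have "?M \<ge> 0" by (simp add: sum_nonneg)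
      ultimately have "?M = 0" by linarith
      then have "\<forall>l\<in>C. norm (w t y l) = 0"
        using fin(1) by (subst (asm) sum_nonneg_eq_0_iff) auto
      then have w0: "w t y l = 0" if "l \<in> C" for l using that by simp
      \<comment> \<open>So far only \<open>B F\<close> vanishes. By \<open>QB\<close> the matrix of
        quotients at the centre is a left inverse of \<open>B\<close>, which recovers
        \<open>F\<close> itself at the point \<open>y\<close>.\<close>
      have "F i t y = 0" if "i \<in> I" for i
      proof -
        have "F i t y = (\<Sum>i'\<in>I. (if i = i' then 1 else 0) * F i' t y)"
          using that fin(2) by (simp add: if_distrib[of "\<lambda>c. c * _"] sum.delta cong: if_cong)
        also have "\<dots> = (\<Sum>i'\<in>I. \<Sum>l\<in>C. Q i l t0 x0 x0 * B l i' * F i' t y)"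
          using that by (simp add: QB[symmetric] sum_distrib_right)
        also have "\<dots> = (\<Sum>l\<in>C. Q i l t0 x0 x0 * w t y l)"
          by (subst sum.swap) (simp add: w_def sum_distrib_left mult.assoc)
        also have "\<dots> = 0" using w0 by simp
        finally show ?thesis .
      qed
      then show "\<exists>y. (\<forall>l. norm (y l - x0 l) \<le> \<eta>) \<and> (\<forall>l. l \<notin> C \<longrightarrow> y l = x0 l) \<and> (\<forall>i\<in>I. F i t y = 0)"
        using y(1) K'[OF y(1)] by (intro exI[of _ y]) (auto simp: K)
    qed (use \<delta> \<rho> in auto)
  qed
  have exist': "\<exists>\<delta>>0. \<forall>t. dist t t0 < \<delta> \<longrightarrow>
      (\<exists>y. (\<forall>l. norm (y l - x0 l) \<le> \<eta>) \<and> (\<forall>l. l \<notin> C \<longrightarrow> y l = x0 l) \<and> (\<forall>i\<in>I. F i t y = 0))"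
    if "0 < \<eta>" for \<eta>
  proof -
    have "0 < min \<eta> (\<rho> / 2)" "min \<eta> (\<rho> / 2) < \<rho>" using that \<rho>(1) by auto
    from exist[OF this] show ?thesis by fastforce
  qed
  show ?thesis
  proof (rule exI[of _ \<rho>], rule conjI[OF \<rho>(1)], rule conjI)
    show "\<forall>t y y'. dist t t0 < \<rho> \<longrightarrow> (\<forall>l. norm (y l - x0 l) < \<rho>) \<longrightarrow>
        (\<forall>l. norm (y' l - x0 l) < \<rho>) \<longrightarrow> (\<forall>l. l \<notin> C \<longrightarrow> y l = y' l) \<longrightarrow>
        (\<forall>i\<in>I. F i t y = 0 \<and> F i t y' = 0) \<longrightarrow> y = y'"
      using unique by (intro allI impI) presburger
  qed (intro allI impI exist')
qed

section \<open>Projective points as normalized lines\<close>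

definition line :: "(nat \<Rightarrow> complex) \<Rightarrow> (nat \<Rightarrow> complex) set" where
  "line x = {y. \<exists>c. c \<noteq> 0 \<and> y = (\<lambda>i. c * x i)}"

lemma line_self: "x \<in> line x"
  unfolding line_def by (auto intro!: exI[of _ 1])

lemma line_scale: "y \<in> line x \<Longrightarrow> c \<noteq> 0 \<Longrightarrow> (\<lambda>i. c * y i) \<in> line x"
  unfolding line_def by (auto simp: mult.assoc[symmetric] intro: exI[of _ "c * _"])

lemma line_eq:
  assumes "y \<in> line x"
  shows "line y = line x"
proof -
  obtain c where c: "c \<noteq> 0" "y = (\<lambda>i. c * x i)" using assms by (auto simp: line_def)
  have "x = (\<lambda>i. inverse c * y i)" using c by auto
  then have "x \<in> line y" using c(1) unfolding line_def by (auto intro!: exI[of _ "inverse c"])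
  have "z \<in> line x" if "z \<in> line y" for z
    using that c line_scale[OF line_self, of _ x] by (auto simp: line_def mult.assoc[symmetric] intro: exI[of _ "_ * c"])
  moreover have "z \<in> line y" if "z \<in> line x" for z
    using that line_scale[OF \<open>x \<in> line y\<close>] by (auto simp: line_def)
  ultimately show ?thesis by blast
qed

lemma proj_space_eq: "proj_space n = line ` hom_coords n"
proof -
  have "proj_rel n `` {x} = line x" if "x \<in> hom_coords n" for x
    using that by (auto simp: proj_rel_def line_def hom_coords_def)
  then show ?thesis
    unfolding proj_space_def quotient_def by auto
qed

text \<open>A compact set that meets every projective point, in representatives unique up to a
  unimodular factor. The maximum norm fits the coordinatewise estimates of Newton's method and is
  invariant under permutations.\<close>

definition max_sphere :: "nat \<Rightarrow> (nat \<Rightarrow> complex) set" where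
  "max_sphere n = {x. (\<forall>i. i \<notin> {1..n+1} \<longrightarrow> x i = 0) \<and> (\<forall>i. norm (x i) \<le> 1) \<and>
     (\<exists>i\<in>{1..n+1}. norm (x i) = 1)}"

lemma max_sphere_hom_coords: "x \<in> max_sphere n \<Longrightarrow> x \<in> hom_coords n"
  by (force simp: max_sphere_def hom_coords_def)

lemma max_sphere_scale: "x \<in> max_sphere n \<Longrightarrow> norm c = 1 \<Longrightarrow> (\<lambda>i. c * x i) \<in> max_sphere n"
  by (auto simp: max_sphere_def norm_mult)

text \<open>The maximum norm \<open>\<mu>\<close> of \<open>x\<close> differs from \<open>1\<close>
  by at most \<open>e\<close>, so dividing by \<open>\<mu>\<close> moves each coordinate by at most
  another \<open>e\<close>.\<close>

lemma hom_coords_normalize: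
  assumes "x \<in> hom_coords n" "x0 \<in> max_sphere n" "\<And>i. norm (x i - x0 i) \<le> e"
  shows "\<exists>c. c \<noteq> 0 \<and> (\<lambda>i. c * x i) \<in> max_sphere n \<and> (\<forall>i. norm (c * x i - x0 i) \<le> 2 * e)"
proof -
  define \<mu> where "\<mu> = Max ((\<lambda>i. norm (x i)) ` {1..n+1})"
  have le: "norm (x i) \<le> \<mu>" if "i \<in> {1..n+1}" for i
    unfolding \<mu>_def using that by (intro Max_ge) auto
  have "\<mu> \<in> (\<lambda>i. norm (x i)) ` {1..n+1}"
    unfolding \<mu>_def by (intro Max_in) auto
  then obtain j where j: "j \<in> {1..n+1}" "norm (x j) = \<mu>" by auto
  obtain i where "i \<in> {1..n+1}" "x i \<noteq> 0" using assms(1) by (auto simp: hom_coords_def)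
  then have "\<mu> > 0" using le[of i] by (metis norm_le_zero_iff not_le order_trans)
  have le': "norm (x i) \<le> \<mu>" for i
    using le[of i] \<open>\<mu> > 0\<close> assms(1) by (cases "i \<in> {1..n+1}") (auto simp: hom_coords_def)
  obtain l where l: "l \<in> {1..n+1}" "norm (x0 l) = 1" using assms(2) by (auto simp: max_sphere_def)
  have "norm (x0 l) \<le> norm (x l) + norm (x l - x0 l)"
    by (metis norm_minus_commute norm_triangle_sub)
  then have "1 - \<mu> \<le> e" using le'[of l] assms(3)[of l] l(2) by linarith
  moreover have "norm (x j) \<le> norm (x0 j) + norm (x j - x0 j)" by (rule norm_triangle_sub)
  moreover have "norm (x0 j) \<le> 1" using assms(2) by (simp add: max_sphere_def)
  ultimately have \<mu>1: "\<bar>1 - \<mu>\<bar> \<le> e" using j(2) assms(3)[of j] by linarith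
  let ?c = "complex_of_real (1 / \<mu>)"
  have "norm (?c * x i - x0 i) \<le> 2 * e" for i
  proof -
    have "norm (?c * x i - x i) = norm ((?c - 1) * x i)" by (simp add: algebra_simps)
    also have "\<dots> = \<bar>1 / \<mu> - 1\<bar> * norm (x i)"
      by (metis norm_mult norm_of_real of_real_1 of_real_diff)
    also have "\<dots> \<le> \<bar>1 / \<mu> - 1\<bar> * \<mu>" using le' by (intro mult_left_mono) auto
    also have "\<dots> = \<bar>(1 / \<mu> - 1) * \<mu>\<bar>" using \<open>\<mu> > 0\<close> by (simp add: abs_mult)
    also have "(1 / \<mu> - 1) * \<mu> = 1 - \<mu>" using \<open>\<mu> > 0\<close> by (simp add: field_simps)
    finally have "norm (?c * x i - x i) \<le> e" using \<mu>1 by linarith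
    moreover have "norm (?c * x i - x0 i) \<le> norm (?c * x i - x i) + norm (x i - x0 i)"
      by (metis dist_norm dist_triangle)
    ultimately show ?thesis using assms(3)[of i] by linarith
  qed
  moreover have "(\<lambda>i. ?c * x i) \<in> max_sphere n"
    using assms(1) le' j \<open>\<mu> > 0\<close>
    by (auto simp: max_sphere_def hom_coords_def norm_divide divide_simps intro!: bexI[of _ j])
  ultimately show ?thesis using \<open>\<mu> > 0\<close> by (intro exI[of _ ?c]) auto
qed

lemma line_normalize:
  assumes "x \<in> hom_coords n"
  shows "\<exists>y\<in>max_sphere n. y \<in> line x"
proof -
  \<comment> \<open>Only the existence of the scaling is wanted, so any point of the sphere serves
    as \<open>x0\<close> and any sufficiently large bound as \<open>e\<close>.\<close>
  define x0 :: "nat \<Rightarrow> complex" where "x0 = (\<lambda>i. if i = 1 then 1 else 0)"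
  define e where "e = Max ((\<lambda>i. norm (x i - x0 i)) ` {1..n+1})"
  have "norm (x i - x0 i) \<le> e" if "i \<in> {1..n+1}" for i
    unfolding e_def using that by (intro Max_ge) auto
  moreover from this[of 1] have "e \<ge> 0" by (auto intro: order_trans[OF norm_ge_zero])
  ultimately have "norm (x i - x0 i) \<le> e" for i
    using assms by (cases "i \<in> {1..n+1}") (auto simp: hom_coords_def x0_def)
  moreover have "x0 \<in> max_sphere n" by (auto simp: max_sphere_def x0_def)
  ultimately show ?thesis
    using hom_coords_normalize[OF assms] unfolding line_def by blast
qed

lemma max_sphere_line_unimodular:
  assumes "x \<in> max_sphere n" "y \<in> max_sphere n" "y \<in> line x"
  shows "\<exists>c. norm c = 1 \<and> y = (\<lambda>i. c * x i)"
proof -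
  obtain c where c: "y = (\<lambda>i. c * x i)" using assms(3) by (auto simp: line_def)
  obtain i where i: "norm (x i) = 1" using assms(1) by (auto simp: max_sphere_def)
  obtain j where j: "norm (y j) = 1" using assms(2) by (auto simp: max_sphere_def)
  have "norm (y i) \<le> 1" using assms(2) by (auto simp: max_sphere_def)
  then have "norm c \<le> 1" using i by (simp add: c norm_mult)
  moreover have "norm (x j) \<le> 1" using assms(1) by (auto simp: max_sphere_def)
  then have "1 \<le> norm c" using j mult_left_mono[of "norm (x j)" 1 "norm c"] by (simp add: c norm_mult)
  ultimately show ?thesis using c by (intro exI[of _ c]) auto
qed

lemma compact_max_sphere: "compact (max_sphere n)"
proof -
  let ?S = "\<lambda>i. if i \<in> {1..n+1} then cball 0 1 else {0 :: complex}"
  let ?U = "\<Union>i\<in>{1..n+1}. {y :: nat \<Rightarrow> complex. norm (y i) = 1}"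
  have "compact {y. \<forall>i. y i \<in> ?S i}" by (rule compact_coordinatewise) auto
  moreover have "closed {y :: nat \<Rightarrow> complex. norm (y i) = 1}" for i
    by (intro closed_Collect_eq continuous_on_norm continuous_on_product_coordinates continuous_on_const)
  then have "closed ?U" by (intro closed_UN) auto
  ultimately have "compact ({y. \<forall>i. y i \<in> ?S i} \<inter> ?U)" by (rule compact_Int_closed)
  also have "{y. \<forall>i. y i \<in> ?S i} \<inter> ?U = max_sphere n"
    unfolding max_sphere_def by (auto split: if_splits) (metis norm_zero zero_le_one)+
  finally show ?thesis .
qed

definition near :: "nat \<Rightarrow> real \<Rightarrow> (nat \<Rightarrow> complex) set \<Rightarrow> (nat \<Rightarrow> complex) set \<Rightarrow> bool" where
  "near n e P R \<longleftrightarrow> (\<exists>x\<in>P \<inter> max_sphere n. \<exists>y\<in>R \<inter> max_sphere n. \<forall>i. norm (x i - y i) < e)"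

text \<open>A unimodular factor can be moved from one representative to the other without changing
  distances, so the representative on one side may be prescribed. The triangle inequality for
  \<open>near\<close> depends on this.\<close>

lemma near_line:
  assumes "x \<in> max_sphere n" "near n e (line x) (line z)"
  shows "\<exists>y\<in>max_sphere n. y \<in> line z \<and> (\<forall>i. norm (y i - x i) < e)"
proof -
  obtain x' y where xy: "x' \<in> line x" "x' \<in> max_sphere n" "y \<in> line z" "y \<in> max_sphere n"
      "\<And>i. norm (x' i - y i) < e"
    using assms(2) by (auto simp: near_def)
  obtain c where c: "norm c = 1" "x' = (\<lambda>i. c * x i)"
    using max_sphere_line_unimodular[OF assms(1) xy(2,1)] by blast
  have c': "norm (inverse c) = 1" "inverse c \<noteq> 0" using c by (auto simp: norm_inverse)
  have "norm (inverse c * y i - x i) < e" for i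
  proof -
    have "c \<noteq> 0" using c by auto
    then have "inverse c * y i - x i = - (inverse c * (x' i - y i))" using c(2) by (simp add: algebra_simps)
    then have "norm (inverse c * y i - x i) = norm (x' i - y i)" using c' by (simp add: norm_mult)
    then show ?thesis using xy(5) by simp
  qed
  then show ?thesis
    using max_sphere_scale[OF xy(4) c'(1)] line_scale[OF xy(3) c'(2)]
    by (intro bexI[of _ "\<lambda>i. inverse c * y i"]) auto
qed

lemma near_sym: "near n e P R \<Longrightarrow> near n e R P"
  unfolding near_def by (metis norm_minus_commute)

lemma near_refl: "x \<in> max_sphere n \<Longrightarrow> e > 0 \<Longrightarrow> near n e (line x) (line x)"
  unfolding near_def using line_self by force

lemma near_mono: "near n e P R \<Longrightarrow> e \<le> e' \<Longrightarrow> near n e' P R"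
  unfolding near_def by (meson less_le_trans)

lemma near_triangle:
  assumes "near n e (line x) (line y)" "near n e' (line y) (line z)"
  shows "near n (e + e') (line x) (line z)"
proof -
  obtain a b where ab: "a \<in> line x" "a \<in> max_sphere n" "b \<in> line y" "b \<in> max_sphere n"
      "\<And>i. norm (a i - b i) < e"
    using assms(1) by (auto simp: near_def)
  have "near n e' (line b) (line z)" using assms(2) line_eq[OF ab(3)] by simp
  then obtain c where c: "c \<in> max_sphere n" "c \<in> line z" "\<And>i. norm (c i - b i) < e'"
    using near_line[OF ab(4)] by blast
  have "norm (a i - c i) < e + e'" for i
  proof -
    have "norm (a i - c i) \<le> norm (a i - b i) + norm (c i - b i)"
      by (metis dist_norm dist_triangle2)
    then show ?thesis using ab(5)[of i] c(3)[of i] by linarith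
  qed
  then show ?thesis unfolding near_def using ab c by blast
qed

lemma hom_coords_permute:
  assumes "p permutes {1..n+1}" "x \<in> hom_coords n"
  shows "x \<circ> p \<in> hom_coords n"
proof -
  obtain i where i: "i \<in> {1..n+1}" "x i \<noteq> 0" using assms(2) by (auto simp: hom_coords_def)
  obtain j where "p j = i" using permutes_surj[OF assms(1)] by (metis surjD)
  then have "j \<in> {1..n+1}" "(x \<circ> p) j \<noteq> 0" using permutes_in_image[OF assms(1)] i by auto
  moreover have "(x \<circ> p) i = 0" if "i \<notin> {1..n+1}" for i
    using that assms(2) permutes_not_in[OF assms(1) that] by (auto simp: hom_coords_def)
  ultimately show ?thesis unfolding hom_coords_def by blast
qed

lemma max_sphere_permute:
  assumes "p permutes {1..n+1}" "x \<in> max_sphere n"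
  shows "x \<circ> p \<in> max_sphere n"
proof -
  obtain i where i: "i \<in> {1..n+1}" "norm (x i) = 1" using assms(2) by (auto simp: max_sphere_def)
  obtain j where "p j = i" using permutes_surj[OF assms(1)] by (metis surjD)
  then have "j \<in> {1..n+1}" "norm ((x \<circ> p) j) = 1" using permutes_in_image[OF assms(1)] i by auto
  moreover have "(x \<circ> p) i = 0" if "i \<notin> {1..n+1}" for i
    using that assms(2) permutes_not_in[OF assms(1) that] by (auto simp: max_sphere_def)
  moreover have "norm ((x \<circ> p) i) \<le> 1" for i using assms(2) by (auto simp: max_sphere_def)
  ultimately show ?thesis unfolding max_sphere_def by blast
qed

lemma line_permute: "(\<lambda>x. x \<circ> p) ` line x = line (x \<circ> p)"
  by (auto simp: line_def image_iff fun_eq_iff o_def) 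

lemma near_permute:
  assumes "p permutes {1..n+1}" "near n e P R"
  shows "near n e ((\<lambda>x. x \<circ> p) ` P) ((\<lambda>x. x \<circ> p) ` R)"
proof -
  obtain x y where "x \<in> P" "x \<in> max_sphere n" "y \<in> R" "y \<in> max_sphere n"
      "\<And>i. norm (x i - y i) < e"
    using assms(2) by (auto simp: near_def)
  then show ?thesis unfolding near_def
    using max_sphere_permute[OF assms(1)] by (intro bexI[of _ "x \<circ> p"] bexI[of _ "y \<circ> p"]) auto
qed

section \<open>Continuation of zeros along a pencil\<close>

lemma sum_shift_index: "(\<Sum>i=1..n. g i) = (\<Sum>i<n. g (i + 1))"
  for g :: "nat \<Rightarrow> 'a::comm_monoid_add"
  by (simp add: sum.atLeast1_atMost_eq)

lemma bij_betw_insert_index: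
  assumes "k \<in> {1..n+1}"
  shows "bij_betw (\<lambda>j. insert_index k (j + 1)) {..<n} ({1..n+1} - {k})"
  \<comment> \<open>Columns count from \<open>0\<close> and skip \<open>k\<close>, so coordinate
    \<open>l\<close> sits in column \<open>l - 1\<close> below \<open>k\<close> and in column
    \<open>l - 2\<close> above it.\<close>
  by (rule bij_betw_byWitness[where f' = "\<lambda>l. if l < k then l - 1 else l - 2"])
     (use assms in \<open>auto simp: insert_index_def split: if_splits\<close>)

text \<open>The adjugate divided by the determinant, as entries with both inverse laws: one gives
  the contraction in Newton's method, the other recovers the equations.\<close>

lemma inverse_matrix_entries:
  fixes A :: "complex mat"
  assumes A: "A \<in> carrier_mat n n" and "Determinant.det A \<noteq> 0"
  shows "\<exists>B. (\<forall>j<n. \<forall>j'<n. (\<Sum>i<n. B j i * A $$ (i, j')) = (if j = j' then 1 else 0)) \<and>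
    (\<forall>i<n. \<forall>i'<n. (\<Sum>j<n. A $$ (i, j) * B j i') = (if i = i' then 1 else 0))"
proof -
  define M where "M = inverse (Determinant.det A) \<cdot>\<^sub>m adj_mat A"
  have M: "M \<in> carrier_mat n n" using adj_mat(1)[OF A] by (simp add: M_def)
  have "M * A = inverse (Determinant.det A) \<cdot>\<^sub>m (adj_mat A * A)"
    unfolding M_def using adj_mat(1)[OF A] A by (rule mult_smult_assoc_mat)
  also have "\<dots> = 1\<^sub>m n"
    unfolding adj_mat(3)[OF A] using assms(2) by (intro eq_matI) auto
  finally have 1: "M * A = 1\<^sub>m n" .
  have "A * M = inverse (Determinant.det A) \<cdot>\<^sub>m (A * adj_mat A)"
    unfolding M_def using A adj_mat(1)[OF A] by (rule mult_smult_distrib)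
  also have "\<dots> = 1\<^sub>m n"
    unfolding adj_mat(2)[OF A] using assms(2) by (intro eq_matI) auto
  finally have 2: "A * M = 1\<^sub>m n" .
  have "(\<Sum>i<n. M $$ (j, i) * A $$ (i, j')) = (M * A) $$ (j, j')" if "j < n" "j' < n" for j j'
    using that M A by (simp add: scalar_prod_def lessThan_atLeast0)
  moreover have "(\<Sum>j<n. A $$ (i, j) * M $$ (j, i')) = (A * M) $$ (i, i')" if "i < n" "i' < n" for i i'
    using that M A by (simp add: scalar_prod_def lessThan_atLeast0)
  ultimately show ?thesis
    unfolding 1 2 by (intro exI[of _ "\<lambda>j i. M $$ (j, i)"]) simp
qed

context form_family
begin

section \<open>Zeros near a nondegenerate zero\<close>

definition zeros :: "complex \<Rightarrow> (nat \<Rightarrow> complex) set set" where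
  "zeros t = {P \<in> proj_space n. \<forall>i\<in>{1..n}. \<forall>x\<in>P. F i t x = 0}"

lemma is_zero_scale: "is_zero t x \<Longrightarrow> is_zero t (\<lambda>i. c * x i)"
  unfolding is_zero_def using form_homogeneous[OF form] by simp

lemma is_zero_line: "y \<in> line x \<Longrightarrow> is_zero t x \<Longrightarrow> is_zero t y"
  unfolding line_def using is_zero_scale by auto

lemma line_in_zeros_iff: "x \<in> hom_coords n \<Longrightarrow> line x \<in> zeros t \<longleftrightarrow> is_zero t x"
  using line_self[of x] is_zero_line[of _ x t]
  unfolding zeros_def proj_space_eq is_zero_def by blast

lemma zerosE:
  assumes "P \<in> zeros t"
  obtains x where "x \<in> max_sphere n" "is_zero t x" "P = line x"
proof -
  obtain x where x: "x \<in> hom_coords n" "P = line x"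
    using assms by (auto simp: zeros_def proj_space_eq)
  obtain y where y: "y \<in> max_sphere n" "y \<in> line x"
    using line_normalize[OF x(1)] by blast
  have "is_zero t x" using assms line_in_zeros_iff[OF x(1)] x(2) by blast
  then show ?thesis using that[OF y(1)] is_zero_line[OF y(2)] line_eq[OF y(2)] x(2) by blast
qed

text \<open>Freezing coordinate \<open>k\<close> at the value \<open>x0 k\<close> leaves
  \<open>n\<close> equations in the \<open>n\<close> unknowns indexed by \<open>C\<close>, and
  \<open>minor k t0 x0\<close> is the determinant of their Jacobian. The value \<open>x0 k\<close>
  need not be \<open>1\<close>.\<close>

lemma chart_local_zero:
  assumes "k \<in> {1..n+1}" "minor k t0 x0 \<noteq> 0" "is_zero t0 x0"
  defines "C \<equiv> {1..n+1} - {k}"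
  shows "\<exists>\<rho>>0.
    (\<forall>t y y'. dist t t0 < \<rho> \<longrightarrow> (\<forall>l. norm (y l - x0 l) < \<rho>) \<longrightarrow> (\<forall>l. norm (y' l - x0 l) < \<rho>) \<longrightarrow>
      (\<forall>l. l \<notin> C \<longrightarrow> y l = y' l) \<longrightarrow> (\<forall>i\<in>{1..n}. F i t y = 0 \<and> F i t y' = 0) \<longrightarrow> y = y') \<and>
    (\<forall>\<eta>>0. \<exists>\<delta>>0. \<forall>t. dist t t0 < \<delta> \<longrightarrow>
      (\<exists>y. (\<forall>l. norm (y l - x0 l) \<le> \<eta>) \<and> (\<forall>l. l \<notin> C \<longrightarrow> y l = x0 l) \<and> (\<forall>i\<in>{1..n}. F i t y = 0)))"
proof -
  define ins where "ins = (\<lambda>j. insert_index k (j + 1))"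
  have ins: "bij_betw ins {..<n} C"
    using bij_betw_insert_index[OF assms(1)] by (simp add: ins_def C_def)
  define A where "A = Matrix.mat n n (\<lambda>(i, j). Q (i + 1) (ins j) t0 x0 x0)"
  have "A \<in> carrier_mat n n" "Determinant.det A \<noteq> 0"
    using assms(2) by (simp_all add: A_def minor_eq[OF assms(1)] ins_def)
  from inverse_matrix_entries[OF this] obtain M where
    M: "\<And>j j'. j < n \<Longrightarrow> j' < n \<Longrightarrow> (\<Sum>i<n. M j i * A $$ (i, j')) = (if j = j' then 1 else 0)"
      "\<And>i i'. i < n \<Longrightarrow> i' < n \<Longrightarrow> (\<Sum>j<n. A $$ (i, j) * M j i') = (if i = i' then 1 else 0)"
    by blast
  define idx where "idx = the_inv_into {..<n} ins"
  have idx: "idx (ins j) = j" if "j < n" for j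
    unfolding idx_def using ins that by (auto intro: the_inv_into_f_f simp: bij_betw_def)
  \<comment> \<open>Translates the inverse matrix from indices below \<open>n\<close> to coordinates
    in \<open>C\<close> and equations in \<open>{1..n}\<close>.\<close>
  define B where "B = (\<lambda>l i. M (idx l) (i - 1))"
  show ?thesis
  proof (rule newton_local_zero[where Q = Q and B = B])
    show "finite C" by (simp add: C_def)
    show "continuous_on UNIV (\<lambda>p. F i (fst p) (snd p))" if "i \<in> {1..n}" for i
      using form_continuous[OF form[OF that]] .
    show "continuous_on UNIV (\<lambda>p. Q i l (fst p) (fst (snd p)) (snd (snd p)))" if "i \<in> {1..n}" for i l
      using quot_continuous[OF form[OF that]] .
    show "F i t y - F i t y' = (\<Sum>l\<in>C. Q i l t y y' * (y l - y' l))"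
      if "i \<in> {1..n}" "\<And>l. l \<notin> C \<Longrightarrow> y l = y' l" for i t y y'
      unfolding quot_eq[OF form[OF that(1)]]
    proof (rule sum.mono_neutral_right)
      show "\<forall>l\<in>{1..n+1} - C. Q i l t y y' * (y l - y' l) = 0"
      proof
        fix l assume "l \<in> {1..n+1} - C"
        then have "y l = y' l" by (intro that(2)) blast
        then show "Q i l t y y' * (y l - y' l) = 0" by simp
      qed
    qed (auto simp: C_def)
    show "(\<Sum>i\<in>{1..n}. B l i * Q i l' t0 x0 x0) = (if l = l' then 1 else 0)"
      if l: "l \<in> C" "l' \<in> C" for l l'
    proof -
      have "l \<in> ins ` {..<n}" "l' \<in> ins ` {..<n}"
        using l bij_betw_imp_surj_on[OF ins] by simp_all
      then obtain j j' where j: "j < n" "l = ins j" "j' < n" "l' = ins j'"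
        by (elim imageE) simp
      have "(\<Sum>i\<in>{1..n}. B l i * Q i l' t0 x0 x0) = (\<Sum>i<n. M j i * A $$ (i, j'))"
        unfolding sum_shift_index using j by (intro sum.cong) (auto simp: B_def idx A_def)
      also have "\<dots> = (if j = j' then 1 else 0)" using M(1) j by blast
      also have "j = j' \<longleftrightarrow> l = l'" using j idx by metis
      finally show ?thesis .
    qed
    show "(\<Sum>l\<in>C. Q i l t0 x0 x0 * B l i') = (if i = i' then 1 else 0)"
      if i: "i \<in> {1..n}" "i' \<in> {1..n}" for i i'
    proof -
      have "(\<Sum>l\<in>C. Q i l t0 x0 x0 * B l i') = (\<Sum>j<n. Q i (ins j) t0 x0 x0 * B (ins j) i')"
        by (rule sum.reindex_bij_betw[OF ins, symmetric])
      also have "\<dots> = (\<Sum>j<n. A $$ (i - 1, j) * M j (i' - 1))"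
        using i by (intro sum.cong) (auto simp: B_def idx A_def)
      also have "\<dots> = (if i - 1 = i' - 1 then 1 else 0)" using i by (intro M(2)) auto
      finally show ?thesis using i by (auto split: if_splits)
    qed
    show "F i t0 x0 = 0" if "i \<in> {1..n}" for i
      using assms(3) that by (simp add: is_zero_def)
  qed simp
qed

text \<open>A nearby zero is rescaled by \<open>x0 k / y k\<close>, which makes its
  \<open>k\<close>-th coordinate equal to \<open>x0 k\<close>. Two such zeros then lie in the same
  chart, where Newton's method gives uniqueness.\<close>

lemma unique_near:
  assumes "x0 \<in> max_sphere n" "k \<in> {1..n+1}" "x0 k \<noteq> 0" "minor k t0 x0 \<noteq> 0" "is_zero t0 x0"
  shows "\<exists>e>0. \<forall>t R R'. dist t t0 < e \<longrightarrow> R \<in> zeros t \<longrightarrow> R' \<in> zeros t \<longrightarrow>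
    near n e (line x0) R \<longrightarrow> near n e (line x0) R' \<longrightarrow> R = R'"
proof -
  obtain \<rho> where \<rho>: "\<rho> > 0" and uniq: "\<And>t y y'. dist t t0 < \<rho> \<Longrightarrow> (\<And>l. norm (y l - x0 l) < \<rho>) \<Longrightarrow>
      (\<And>l. norm (y' l - x0 l) < \<rho>) \<Longrightarrow> (\<And>l. l \<notin> {1..n+1} - {k} \<Longrightarrow> y l = y' l) \<Longrightarrow>
      is_zero t y \<Longrightarrow> is_zero t y' \<Longrightarrow> y = y'"
    using chart_local_zero[OF assms(2,4,5)] unfolding is_zero_def by (elim exE conjE) (metis (no_types, lifting))
  define a where "a = norm (x0 k)"
  have a: "a > 0" "a \<le> 1" using assms(1,3) by (auto simp: a_def max_sphere_def)
  \<comment> \<open>The bound \<open>a / 2\<close> ensures \<open>norm (y k) > a / 2\<close>. The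
    rescaled representative is then within \<open>4 * e / a\<close> of \<open>x0\<close>, hence
    \<open>\<rho> * a / 4\<close>. The bound \<open>\<rho>\<close> is for the parameter.\<close>
  define e where "e = min (\<rho> * a / 4) (min (a / 2) \<rho>)"
  have e: "e > 0" "e \<le> \<rho> * a / 4" "e \<le> a / 2" "e \<le> \<rho>" using a \<rho> by (auto simp: e_def)
  have rescale: "\<exists>z. z \<in> line x \<and> is_zero t z \<and> z k = x0 k \<and> (\<forall>l. norm (z l - x0 l) < \<rho>) \<and>
      (\<forall>l. l \<notin> {1..n+1} \<longrightarrow> z l = 0)"
    if x: "x \<in> max_sphere n" "is_zero t x" "near n e (line x0) (line x)" for x t
  proof -
    obtain y where y: "y \<in> max_sphere n" "y \<in> line x" "\<And>l. norm (y l - x0 l) < e"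
      using near_line[OF assms(1) x(3)] by blast
    have "a \<le> norm (y k) + norm (y k - x0 k)"
      unfolding a_def by (metis norm_minus_commute norm_triangle_sub)
    then have yk: "norm (y k) > a / 2" using y(3)[of k] e(3) by linarith
    then have "y k \<noteq> 0" using a by auto
    define c where "c = x0 k / y k"
    have c: "c \<noteq> 0" using \<open>y k \<noteq> 0\<close> assms(3) by (simp add: c_def)
    have "norm (c * y l - x0 l) < \<rho>" for l
    proof -
      have "c * y l - x0 l = (x0 k * (y l - x0 l) - x0 l * (y k - x0 k)) / y k"
        using \<open>y k \<noteq> 0\<close> by (simp add: c_def field_simps)
      then have "norm (c * y l - x0 l) = norm (x0 k * (y l - x0 l) - x0 l * (y k - x0 k)) / norm (y k)"
        by (simp add: norm_divide)
      also have "norm (x0 k * (y l - x0 l) - x0 l * (y k - x0 k)) \<le>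
          norm (x0 k) * norm (y l - x0 l) + norm (x0 l) * norm (y k - x0 k)"
        by (metis norm_mult norm_triangle_ineq4)
      also have "\<dots> \<le> 1 * norm (y l - x0 l) + 1 * norm (y k - x0 k)"
        using assms(1) by (intro add_mono mult_right_mono) (auto simp: max_sphere_def)
      finally have "norm (c * y l - x0 l) \<le> (norm (y l - x0 l) + norm (y k - x0 k)) / norm (y k)"
        using \<open>y k \<noteq> 0\<close> by (simp add: divide_right_mono)
      also have "\<dots> < 2 * e / norm (y k)"
        using y(3)[of l] y(3)[of k] \<open>y k \<noteq> 0\<close> by (intro divide_strict_right_mono) auto
      also have "\<dots> \<le> 2 * e / (a / 2)"
        using yk a e(1) \<open>y k \<noteq> 0\<close> by (intro divide_left_mono) auto
      also have "\<dots> \<le> \<rho>" using e(2) a by (simp add: field_simps)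
      finally show ?thesis .
    qed
    then show ?thesis
      using line_scale[OF y(2) c] is_zero_scale[OF is_zero_line[OF y(2) x(2)], of c] \<open>y k \<noteq> 0\<close> y(1)
      by (intro exI[of _ "\<lambda>i. c * y i"]) (auto simp: c_def max_sphere_def)
  qed
  have "R = R'" if t: "dist t t0 < e" and R: "R \<in> zeros t" "R' \<in> zeros t"
    "near n e (line x0) R" "near n e (line x0) R'" for t R R'
  proof -
    obtain x x' where x: "x \<in> max_sphere n" "is_zero t x" "R = line x"
      "x' \<in> max_sphere n" "is_zero t x'" "R' = line x'"
      using R(1,2) by (auto elim!: zerosE)
    obtain z where z: "z \<in> line x" "is_zero t z" "z k = x0 k" "\<And>l. norm (z l - x0 l) < \<rho>"
        "\<And>l. l \<notin> {1..n+1} \<Longrightarrow> z l = 0"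
      using rescale[OF x(1,2)] R(3) x(3) by blast
    obtain z' where z': "z' \<in> line x'" "is_zero t z'" "z' k = x0 k" "\<And>l. norm (z' l - x0 l) < \<rho>"
        "\<And>l. l \<notin> {1..n+1} \<Longrightarrow> z' l = 0"
      using rescale[OF x(4,5)] R(4) x(6) by blast
    have "z = z'"
    proof (rule uniq[OF _ z(4) z'(4) _ z(2) z'(2)])
      show "dist t t0 < \<rho>" using t e by linarith
      show "z l = z' l" if "l \<notin> {1..n+1} - {k}" for l
        using that z(3,5) z'(3,5) by (cases "l = k") auto
    qed
    then show "R = R'" using line_eq[OF z(1)] line_eq[OF z'(1)] x by simp
  qed
  then show ?thesis using e(1) by blast
qed

lemma exists_near:
  assumes "x0 \<in> max_sphere n" "k \<in> {1..n+1}" "x0 k \<noteq> 0" "minor k t0 x0 \<noteq> 0" "is_zero t0 x0" "e > 0"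
  shows "\<exists>\<delta>>0. \<forall>t. dist t t0 < \<delta> \<longrightarrow> (\<exists>R\<in>zeros t. near n e (line x0) R)"
proof -
  \<comment> \<open>Normalization to the sphere doubles the distance, and \<open>2 * (e / 3)\<close>
    is still below \<open>e\<close>.\<close>
  have "e / 3 > 0" using assms(6) by simp
  then obtain \<delta> where \<delta>: "\<delta> > 0" "\<And>t. dist t t0 < \<delta> \<Longrightarrow> \<exists>y. (\<forall>l. norm (y l - x0 l) \<le> e / 3) \<and>
      (\<forall>l. l \<notin> {1..n+1} - {k} \<longrightarrow> y l = x0 l) \<and> is_zero t y"
    using chart_local_zero[OF assms(2,4,5)] unfolding is_zero_def by (elim exE conjE) (metis (no_types, lifting))
  have "\<exists>R\<in>zeros t. near n e (line x0) R" if t: "dist t t0 < \<delta>" for t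
  proof -
    obtain y where y: "\<And>l. norm (y l - x0 l) \<le> e / 3" "\<And>l. l \<notin> {1..n+1} - {k} \<Longrightarrow> y l = x0 l"
        "is_zero t y"
      using \<delta>(2)[OF t] by blast
    have "y k \<noteq> 0" using y(2)[of k] assms(3) by simp
    moreover have "y l = 0" if "l \<notin> {1..n+1}" for l
    proof -
      have "l \<notin> {1..n+1} - {k}" using that by blast
      moreover have "x0 l = 0" using that assms(1) unfolding max_sphere_def by blast
      ultimately show ?thesis using y(2) by metis
    qed
    ultimately have yh: "y \<in> hom_coords n" using assms(2) by (auto simp: hom_coords_def)
    then obtain c where c: "c \<noteq> 0" "(\<lambda>i. c * y i) \<in> max_sphere n" "\<And>i. norm (c * y i - x0 i) \<le> 2 * (e / 3)"
      using hom_coords_normalize[OF yh assms(1) y(1)] by blast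
    have "norm (x0 i - c * y i) < e" for i
      using c(3)[of i] assms(6) by (simp add: norm_minus_commute)
    then have "near n e (line x0) (line y)"
      unfolding near_def using assms(1) line_self line_scale[OF line_self c(1)] c(2)
      by (intro bexI[of _ x0] bexI[of _ "\<lambda>i. c * y i"]) auto
    then show ?thesis using line_in_zeros_iff[OF yh] y(3) by blast
  qed
  then show ?thesis using \<delta>(1) by blast
qed

section \<open>Finiteness and semicontinuity of the zero set by compactness\<close>

lemma nondegenerateE:
  assumes "nondegenerate t" "x \<in> max_sphere n" "is_zero t x"
  obtains k where "k \<in> {1..n+1}" "x k \<noteq> 0" "minor k t x \<noteq> 0"
  using assms max_sphere_hom_coords unfolding nondegenerate_def by blast

text \<open>Only finitely many coordinates are restricted, which keeps the set open in the product
  topology. On the sphere the other coordinates vanish, and \<open>near_sphereI\<close> passes to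
  all of them.\<close>

lemma open_uniform_nbhd:
  fixes z :: "nat \<Rightarrow> complex"
  shows "open {x. \<forall>i\<in>{1..n+1}. norm (z i - x i) < e}"
proof -
  have "open {x. norm (z i - x i) < e}" for i
    by (intro open_Collect_less continuous_on_norm continuous_on_diff
        continuous_on_product_coordinates continuous_on_const)
  then have "open (\<Inter>i\<in>{1..n+1}. {x. norm (z i - x i) < e})" by (intro open_INT) auto
  also have "(\<Inter>i\<in>{1..n+1}. {x. norm (z i - x i) < e}) = {x. \<forall>i\<in>{1..n+1}. norm (z i - x i) < e}"
    by auto
  finally show ?thesis .
qed

lemma near_sphereI:
  assumes "x \<in> max_sphere n" "y \<in> max_sphere n" "\<forall>i\<in>{1..n+1}. norm (x i - y i) < e"
  shows "near n e (line x) (line y)"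
proof -
  have "norm (x i - y i) < e" for i
  proof (cases "i \<in> {1..n+1}")
    case False
    have "0 < e" using assms(3) order_le_less_trans[OF norm_ge_zero] by fastforce
    then show ?thesis using False assms(1,2) by (simp add: max_sphere_def)
  qed (use assms(3) in blast)
  then show ?thesis unfolding near_def using assms line_self by blast
qed

lemma closed_is_zero: "closed {p. is_zero (fst p) (snd p)}"
proof -
  have "closed {p. F i (fst p) (snd p) = 0}" if "i \<in> {1..n}" for i
    by (intro closed_Collect_eq form_continuous[OF form[OF that]] continuous_on_const)
  then have "closed (\<Inter>i\<in>{1..n}. {p. F i (fst p) (snd p) = 0})" by auto
  also have "(\<Inter>i\<in>{1..n}. {p. F i (fst p) (snd p) = 0}) = {p. is_zero (fst p) (snd p)}"
    by (auto simp: is_zero_def)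
  finally show ?thesis .
qed

text \<open>The case of a constant parameter in \<open>unique_near\<close> isolates each zero.
  Finitely many of the isolating neighbourhoods cover the compact set of normalized zeros, and each
  contains a single projective point.\<close>

lemma finite_zeros:
  assumes "nondegenerate t"
  shows "finite (zeros t)"
proof -
  define K where "K = {x \<in> max_sphere n. is_zero t x}"
  have "closed ((\<lambda>x. (t, x)) -` {p. is_zero (fst p) (snd p)})"
    by (intro closed_vimage closed_is_zero continuous_intros)
  then have "compact K"
    unfolding K_def using compact_Int_closed[OF compact_max_sphere, of _ n] by (simp add: Collect_conj_eq vimage_def)
  have "\<forall>x\<in>K. \<exists>e>0. \<forall>R R'. R \<in> zeros t \<longrightarrow> R' \<in> zeros t \<longrightarrow>
      near n e (line x) R \<longrightarrow> near n e (line x) R' \<longrightarrow> R = R'"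
  proof
    fix x assume "x \<in> K"
    then have x: "x \<in> max_sphere n" "is_zero t x" by (auto simp: K_def)
    obtain k where k: "k \<in> {1..n+1}" "x k \<noteq> 0" "minor k t x \<noteq> 0"
      using nondegenerateE[OF assms x] .
    from unique_near[OF x(1) k x(2)]
    show "\<exists>e>0. \<forall>R R'. R \<in> zeros t \<longrightarrow> R' \<in> zeros t \<longrightarrow>
      near n e (line x) R \<longrightarrow> near n e (line x) R' \<longrightarrow> R = R'"
      by (metis dist_self)
  qed
  from bchoice[OF this] obtain e where e: "\<forall>x\<in>K. e x > 0 \<and> (\<forall>R R'. R \<in> zeros t \<longrightarrow> R' \<in> zeros t \<longrightarrow>
      near n (e x) (line x) R \<longrightarrow> near n (e x) (line x) R' \<longrightarrow> R = R')" ..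
  define U where "U = (\<lambda>z. {x. \<forall>i\<in>{1..n+1}. norm (z i - x i) < e z})"
  have "K \<subseteq> (\<Union>z\<in>K. U z)" using e by (auto simp: U_def)
  then obtain D where D: "D \<subseteq> K" "finite D" "K \<subseteq> (\<Union>z\<in>D. U z)"
    by (rule compactE_image[OF \<open>compact K\<close>, rotated]) (auto simp only: U_def open_uniform_nbhd)
  have "zeros t \<subseteq> line ` D"
  proof
    fix P assume P: "P \<in> zeros t"
    then obtain x where x: "x \<in> max_sphere n" "is_zero t x" "P = line x" by (rule zerosE)
    then have "x \<in> K" by (simp add: K_def)
    then obtain z where z: "z \<in> D" "x \<in> U z" using D(3) by blast
    then have zK: "z \<in> K" "z \<in> max_sphere n" "is_zero t z" using D(1) by (auto simp: K_def)
    have "near n (e z) (line z) (line x)"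
      using z(2) zK(2) x(1) by (intro near_sphereI) (auto simp: U_def)
    moreover have "near n (e z) (line z) (line z)" using near_refl[OF zK(2)] e zK(1) by blast
    moreover have "line z \<in> zeros t"
      using line_in_zeros_iff[OF max_sphere_hom_coords[OF zK(2)]] zK(3) by blast
    ultimately have "line x = line z" using e zK(1) P x(3) by blast
    then show "P \<in> line ` D" using z(1) x(3) by blast
  qed
  then show ?thesis using D(2) by (meson finite_imageI finite_subset)
qed

text \<open>No zero appears far from the old ones. The set \<open>A\<close> of pairs of a parameter
  and a normalized zero that is not near any zero at \<open>t0\<close> is compact and contains no
  pair over \<open>t0\<close>, so its parameters keep a positive distance from
  \<open>t0\<close>.\<close>

lemma zeros_near_limit:
  assumes "e > 0"
  shows "\<exists>\<delta>>0. \<forall>t. dist t t0 < \<delta> \<longrightarrow> (\<forall>R\<in>zeros t. \<exists>P\<in>zeros t0. near n e P R)"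
proof -
  define Z where "Z = {z \<in> max_sphere n. is_zero t0 z}"
  define A where "A = (cball t0 1 \<times> max_sphere n) \<inter> ({p. is_zero (fst p) (snd p)} \<inter>
     - (\<Union>z\<in>Z. UNIV \<times> {x. \<forall>i\<in>{1..n+1}. norm (z i - x i) < e}))"
  have "open (\<Union>z\<in>Z. (UNIV :: complex set) \<times> {x. \<forall>i\<in>{1..n+1}. norm (z i - x i) < e})"
    by (intro open_UN open_Times open_uniform_nbhd ballI) auto
  then have "compact A"
    unfolding A_def
    by (intro compact_Int_closed compact_Times compact_cball compact_max_sphere closed_Int
        closed_is_zero closed_Compl)
  have far: "fst p \<noteq> t0" if "p \<in> A" for p
  proof
    assume "fst p = t0"
    then have "snd p \<in> Z" using that by (auto simp: A_def Z_def)
    moreover have "p \<in> UNIV \<times> {x. \<forall>i\<in>{1..n+1}. norm (snd p i - x i) < e}"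
      using assms by (cases p) auto
    ultimately have "p \<in> (\<Union>z\<in>Z. UNIV \<times> {x. \<forall>i\<in>{1..n+1}. norm (z i - x i) < e})" by blast
    then show False using that by (auto simp: A_def)
  qed
  have "\<exists>\<delta>>0. \<delta> \<le> 1 \<and> (\<forall>p\<in>A. \<delta> \<le> dist (fst p) t0)"
  proof (cases "A = {}")
    case False
    have "continuous_on A (\<lambda>p. dist (fst p) t0)" by (intro continuous_intros)
    from continuous_attains_inf[OF \<open>compact A\<close> False this]
    obtain q where "q \<in> A" "\<forall>p\<in>A. dist (fst q) t0 \<le> dist (fst p) t0" by blast
    then show ?thesis using far[of q] by (intro exI[of _ "min 1 (dist (fst q) t0)"]) auto
  qed (auto intro: exI[of _ 1])
  then obtain \<delta> where \<delta>: "\<delta> > 0" "\<delta> \<le> 1" "\<And>p. p \<in> A \<Longrightarrow> \<delta> \<le> dist (fst p) t0" by blast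
  have "\<exists>P\<in>zeros t0. near n e P R" if t: "dist t t0 < \<delta>" and "R \<in> zeros t" for t R
  proof -
    obtain x where x: "x \<in> max_sphere n" "is_zero t x" "R = line x"
      using \<open>R \<in> zeros t\<close> by (rule zerosE)
    have "(t, x) \<notin> A" using \<delta>(3)[of "(t, x)"] t by auto
    then obtain z where z: "z \<in> Z" "\<forall>i\<in>{1..n+1}. norm (z i - x i) < e"
      using x t \<delta>(2) by (auto simp: A_def dist_commute)
    then have "z \<in> max_sphere n" "is_zero t0 z" by (auto simp: Z_def)
    then show ?thesis
      using near_sphereI[OF _ x(1) z(2)] line_in_zeros_iff[OF max_sphere_hom_coords] x(3) by blast
  qed
  then show ?thesis using \<delta>(1) by blast
qed

section \<open>Equivariant matching of zeros\<close>

text \<open>Invariance is required at every parameter, so the same permutations act on all zero sets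
  of the pencil and matchings can be composed.\<close>

definition symmetries :: "(nat \<Rightarrow> nat) set" where
  "symmetries = {\<sigma>. \<sigma> permutes {1..n+1} \<and>
     (\<forall>i\<in>{1..n}. \<forall>t x. F i t (x \<circ> inv_into UNIV \<sigma>) = F i t x)}"

text \<open>The action without restriction to a zero set, since the matching compares points of
  different zero sets.\<close>

definition act :: "(nat \<Rightarrow> nat) \<Rightarrow> (nat \<Rightarrow> complex) set \<Rightarrow> (nat \<Rightarrow> complex) set" where
  "act \<sigma> P = (\<lambda>x. x \<circ> inv_into UNIV \<sigma>) ` P"

lemma act_zeros:
  assumes "\<sigma> \<in> symmetries" "P \<in> zeros t"
  shows "act \<sigma> P \<in> zeros t"
proof -
  obtain x where x: "x \<in> max_sphere n" "is_zero t x" "P = line x" using assms(2) by (rule zerosE)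
  have p: "inv_into UNIV \<sigma> permutes {1..n+1}"
    using assms(1) by (auto simp: symmetries_def intro: permutes_inv)
  have "is_zero t (x \<circ> inv_into UNIV \<sigma>)" using x(2) assms(1) by (simp add: is_zero_def symmetries_def)
  then show ?thesis
    using line_in_zeros_iff[OF hom_coords_permute[OF p max_sphere_hom_coords[OF x(1)]]]
    by (simp add: act_def x(3) line_permute)
qed

lemma near_act: "\<sigma> \<in> symmetries \<Longrightarrow> near n e P R \<Longrightarrow> near n e (act \<sigma> P) (act \<sigma> R)"
  unfolding act_def by (rule near_permute) (auto simp: symmetries_def intro: permutes_inv)

definition equivalent :: "complex \<Rightarrow> complex \<Rightarrow> bool" where
  "equivalent t s \<longleftrightarrow> (\<exists>h. bij_betw h (zeros t) (zeros s) \<and>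
     (\<forall>\<sigma>\<in>symmetries. \<forall>P\<in>zeros t. h (act \<sigma> P) = act \<sigma> (h P)))"

lemma equivalent_sym:
  assumes "equivalent t s"
  shows "equivalent s t"
proof -
  obtain h where h: "bij_betw h (zeros t) (zeros s)"
      "\<And>\<sigma> P. \<sigma> \<in> symmetries \<Longrightarrow> P \<in> zeros t \<Longrightarrow> h (act \<sigma> P) = act \<sigma> (h P)"
    using assms by (auto simp: equivalent_def)
  let ?g = "inv_into (zeros t) h"
  have "?g (act \<sigma> R) = act \<sigma> (?g R)" if "\<sigma> \<in> symmetries" "R \<in> zeros s" for \<sigma> R
  proof -
    have g: "?g R \<in> zeros t" "h (?g R) = R"
      using bij_betw_apply[OF bij_betw_inv_into[OF h(1)] that(2)]
        bij_betw_inv_into_right[OF h(1) that(2)] by simp_all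
    have "h (act \<sigma> (?g R)) = act \<sigma> R" using h(2)[OF that(1) g(1)] g(2) by simp
    then show ?thesis
      using inv_into_f_f[OF bij_betw_imp_inj_on[OF h(1)] act_zeros[OF that(1) g(1)]] by simp
  qed
  then show ?thesis using bij_betw_inv_into[OF h(1)] by (auto simp: equivalent_def)
qed

lemma equivalent_trans:
  assumes "equivalent t s" "equivalent s r"
  shows "equivalent t r"
proof -
  obtain h where h: "bij_betw h (zeros t) (zeros s)"
      "\<And>\<sigma> P. \<sigma> \<in> symmetries \<Longrightarrow> P \<in> zeros t \<Longrightarrow> h (act \<sigma> P) = act \<sigma> (h P)"
    using assms(1) by (auto simp: equivalent_def)
  obtain g where g: "bij_betw g (zeros s) (zeros r)"
      "\<And>\<sigma> P. \<sigma> \<in> symmetries \<Longrightarrow> P \<in> zeros s \<Longrightarrow> g (act \<sigma> P) = act \<sigma> (g P)"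
    using assms(2) by (auto simp: equivalent_def)
  have "(g \<circ> h) (act \<sigma> P) = act \<sigma> ((g \<circ> h) P)" if "\<sigma> \<in> symmetries" "P \<in> zeros t" for \<sigma> P
    using h(2)[OF that] g(2)[OF that(1) bij_betwE[OF h(1), rule_format, OF that(2)]] by simp
  then show ?thesis unfolding equivalent_def
    using bij_betw_trans[OF h(1) g(1)] by blast
qed

text \<open>Existence holds within \<open>\<epsilon> / 2\<close> and uniqueness within
  \<open>\<epsilon>\<close>. The margin yields injectivity: two zeros matched with the same zero are
  within \<open>\<epsilon>\<close> of each other. Surjectivity is \<open>zeros_near_limit\<close>,
  and uniqueness makes the choice in \<open>h\<close> canonical.\<close>

lemma locally_equivalent:
  assumes nd: "nondegenerate t0"
  shows "\<exists>\<delta>>0. \<forall>t. dist t t0 < \<delta> \<longrightarrow> equivalent t0 t"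
proof -
  have fin: "finite (zeros t0)" by (rule finite_zeros[OF nd])
  have "\<forall>P\<in>zeros t0. \<exists>e>0. \<forall>t R R'. dist t t0 < e \<longrightarrow> R \<in> zeros t \<longrightarrow> R' \<in> zeros t \<longrightarrow>
      near n e P R \<longrightarrow> near n e P R' \<longrightarrow> R = R'"
  proof
    fix P assume "P \<in> zeros t0"
    then obtain x where x: "x \<in> max_sphere n" "is_zero t0 x" "P = line x" by (rule zerosE)
    obtain k where k: "k \<in> {1..n+1}" "x k \<noteq> 0" "minor k t0 x \<noteq> 0"
      using nondegenerateE[OF nd x(1,2)] .
    show "\<exists>e>0. \<forall>t R R'. dist t t0 < e \<longrightarrow> R \<in> zeros t \<longrightarrow> R' \<in> zeros t \<longrightarrow>
      near n e P R \<longrightarrow> near n e P R' \<longrightarrow> R = R'"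
      using unique_near[OF x(1) k x(2)] unfolding x(3) .
  qed
  from bchoice[OF this] obtain e where e: "\<forall>P\<in>zeros t0. e P > 0 \<and> (\<forall>t R R'. dist t t0 < e P \<longrightarrow>
      R \<in> zeros t \<longrightarrow> R' \<in> zeros t \<longrightarrow> near n (e P) P R \<longrightarrow> near n (e P) P R' \<longrightarrow> R = R')" ..
  define \<epsilon> where "\<epsilon> = Min (insert 1 (e ` zeros t0))"
  have \<epsilon>: "\<epsilon> > 0" "\<And>P. P \<in> zeros t0 \<Longrightarrow> \<epsilon> \<le> e P"
    using fin e by (auto simp: \<epsilon>_def)
  have uniq: "R = R'" if "P \<in> zeros t0" "dist t t0 < \<epsilon>" "R \<in> zeros t" "R' \<in> zeros t"
      "near n \<epsilon> P R" "near n \<epsilon> P R'" for t P R R'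
  proof -
    have "dist t t0 < e P" using \<epsilon>(2)[OF that(1)] that(2) by linarith
    then show ?thesis
      using e that near_mono[OF that(5) \<epsilon>(2)[OF that(1)]] near_mono[OF that(6) \<epsilon>(2)[OF that(1)]] by blast
  qed
  have "\<forall>P\<in>zeros t0. \<exists>\<delta>>0. \<forall>t. dist t t0 < \<delta> \<longrightarrow> (\<exists>R\<in>zeros t. near n (\<epsilon> / 2) P R)"
  proof
    fix P assume "P \<in> zeros t0"
    then obtain x where x: "x \<in> max_sphere n" "is_zero t0 x" "P = line x" by (rule zerosE)
    obtain k where k: "k \<in> {1..n+1}" "x k \<noteq> 0" "minor k t0 x \<noteq> 0"
      using nondegenerateE[OF nd x(1,2)] .
    show "\<exists>\<delta>>0. \<forall>t. dist t t0 < \<delta> \<longrightarrow> (\<exists>R\<in>zeros t. near n (\<epsilon> / 2) P R)"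
      using exists_near[OF x(1) k x(2)] \<epsilon>(1) unfolding x(3) by simp
  qed
  from bchoice[OF this] obtain \<delta>1 where \<delta>1: "\<forall>P\<in>zeros t0. \<delta>1 P > 0 \<and>
      (\<forall>t. dist t t0 < \<delta>1 P \<longrightarrow> (\<exists>R\<in>zeros t. near n (\<epsilon> / 2) P R))" ..
  obtain \<delta>2 where \<delta>2: "\<delta>2 > 0" "\<And>t R. dist t t0 < \<delta>2 \<Longrightarrow> R \<in> zeros t \<Longrightarrow> \<exists>P\<in>zeros t0. near n (\<epsilon> / 2) P R"
    using zeros_near_limit[of "\<epsilon> / 2" t0] \<epsilon>(1) by auto
  define \<delta> where "\<delta> = Min (insert \<epsilon> (insert \<delta>2 (\<delta>1 ` zeros t0)))"
  have \<delta>: "\<delta> > 0" "\<delta> \<le> \<epsilon>" "\<delta> \<le> \<delta>2" "\<And>P. P \<in> zeros t0 \<Longrightarrow> \<delta> \<le> \<delta>1 P"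
  proof -
    have fin': "finite (insert \<epsilon> (insert \<delta>2 (\<delta>1 ` zeros t0)))" using fin by simp
    show "\<delta> > 0" unfolding \<delta>_def using fin \<epsilon>(1) \<delta>1 \<delta>2(1) by (subst Min_gr_iff) auto
    show "\<delta> \<le> \<epsilon>" "\<delta> \<le> \<delta>2" "\<And>P. P \<in> zeros t0 \<Longrightarrow> \<delta> \<le> \<delta>1 P"
      unfolding \<delta>_def by (auto intro!: Min_le[OF fin'])
  qed
  have "equivalent t0 t" if t: "dist t t0 < \<delta>" for t
  proof -
    define h where "h = (\<lambda>P. SOME R. R \<in> zeros t \<and> near n (\<epsilon> / 2) P R)"
    have h: "h P \<in> zeros t" "near n (\<epsilon> / 2) P (h P)" if P: "P \<in> zeros t0" for P
    proof -
      have "dist t t0 < \<delta>1 P" using t \<delta>(4)[OF P] by linarith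
      then have "\<exists>R. R \<in> zeros t \<and> near n (\<epsilon> / 2) P R" using \<delta>1 P by blast
      from someI_ex[OF this] show "h P \<in> zeros t" "near n (\<epsilon> / 2) P (h P)" by (auto simp: h_def)
    qed
    have t': "dist t t0 < \<epsilon>" "dist t t0 < \<delta>2" using t \<delta> by linarith+
    have heq: "h P = R" if P: "P \<in> zeros t0" and R: "R \<in> zeros t" "near n (\<epsilon> / 2) P R" for P R
      by (rule uniq[OF P t'(1) h(1)[OF P] R(1)])
         (use near_mono[OF h(2)[OF P]] near_mono[OF R(2)] \<epsilon>(1) in auto)
    have "inj_on h (zeros t0)"
    proof (rule inj_onI)
      fix P P' assume P: "P \<in> zeros t0" "P' \<in> zeros t0" "h P = h P'"
      obtain x where x: "x \<in> max_sphere n" "P = line x" using P(1) by (rule zerosE)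
      obtain x' where x': "P' = line x'" using P(2) by (rule zerosE)
      obtain z where z: "h P = line z" using h(1)[OF P(1)] by (rule zerosE)
      have "near n (\<epsilon> / 2) P (h P)" "near n (\<epsilon> / 2) (h P) P'"
        using h(2)[OF P(1)] near_sym[OF h(2)[OF P(2)]] P(3) by auto
      then have "near n (\<epsilon> / 2 + \<epsilon> / 2) P P'"
        unfolding x(2) x' z[unfolded x(2)] by (rule near_triangle)
      \<comment> \<open>Uniqueness is applied at the parameter \<open>t0\<close> itself, where both
        \<open>P\<close> and \<open>P'\<close> are zeros near \<open>P\<close>.\<close>
      moreover have "near n \<epsilon> P P" unfolding x(2) by (rule near_refl[OF x(1) \<epsilon>(1)])
      ultimately show "P = P'" using uniq[OF P(1) _ P(1,2)] \<epsilon>(1) by simp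
    qed
    moreover have "h ` zeros t0 = zeros t"
    proof
      show "zeros t \<subseteq> h ` zeros t0"
      proof
        fix R assume R: "R \<in> zeros t"
        then obtain P where P: "P \<in> zeros t0" "near n (\<epsilon> / 2) P R" using \<delta>2(2)[OF t'(2)] by blast
        then show "R \<in> h ` zeros t0" using heq[OF P(1) R P(2)] by blast
      qed
    qed (use h(1) in blast)
    moreover have "h (act \<sigma> P) = act \<sigma> (h P)" if "\<sigma> \<in> symmetries" "P \<in> zeros t0" for \<sigma> P
      by (rule heq[OF act_zeros[OF that] act_zeros[OF that(1) h(1)[OF that(2)]]
            near_act[OF that(1) h(2)[OF that(2)]]])
    ultimately show ?thesis unfolding equivalent_def bij_betw_def by blast
  qed
  then show ?thesis using \<delta>(1) by blast
qed

lemma nondegenerate_equivalent: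
  assumes "nondegenerate t" "nondegenerate s"
  shows "equivalent t s"
proof (rule connected_equivalence_relation[where S = "{r. nondegenerate r}"])
  have "connected (UNIV - {r. \<not> nondegenerate r})"
    using finite_degenerate[OF assms(1)]
    by (intro connected_open_diff_countable) (auto simp: countable_finite)
  moreover have "UNIV - {r. \<not> nondegenerate r} = {r. nondegenerate r}" by auto
  ultimately show "connected {r. nondegenerate r}" by simp
  show "\<exists>T. openin (top_of_set {r. nondegenerate r}) T \<and> a \<in> T \<and> (\<forall>x\<in>T. equivalent a x)"
    if a: "a \<in> {r. nondegenerate r}" for a
  proof -
    obtain \<delta> where \<delta>: "\<delta> > 0" "\<And>t. dist t a < \<delta> \<Longrightarrow> equivalent a t"
      using locally_equivalent a by blast
    then show ?thesis using a
      by (intro exI[of _ "{r. nondegenerate r} \<inter> ball a \<delta>"]) (auto simp: dist_commute openin_open_Int)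
  qed
  show "equivalent b a" if "equivalent a b" for a b
    using that by (rule equivalent_sym)
  show "equivalent a c" if "equivalent a b" "equivalent b c" for a b c
    using that by (rule equivalent_trans)
qed (use assms in simp_all)

end

section \<open>Symmetric polynomials and the Fermat system\<close>

lemma form_eval_mpoly:
  assumes "in_vars {1..m} f" "homogeneous d f"
  shows "form m d (\<lambda>t x. eval_mpoly f x)"
  unfolding eval_mpoly_def
proof (intro form_sum form_scale)
  fix a assume a: "a \<in> Poly_Mapping.keys f"
  have "form m (\<Sum>i\<in>Poly_Mapping.keys a. Poly_Mapping.lookup a i * 1)
      (\<lambda>t x. \<Prod>i\<in>Poly_Mapping.keys a. x i ^ Poly_Mapping.lookup a i)"
    by (intro form_prod form_power form_var) (use a assms(1) in \<open>unfold in_vars_def, blast\<close>)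
  then show "form m d (\<lambda>t x. \<Prod>i\<in>Poly_Mapping.keys a. x i ^ Poly_Mapping.lookup a i)"
    using a assms(2) by (simp add: homogeneous_def)
qed

text \<open>Pulling back along \<open>\<sigma>\<close> is an injection of the finite set of
  monomials of \<open>f\<close> into itself, hence a bijection, and it preserves coefficients. The
  sum defining the value is reindexed along it.\<close>

lemma eval_mpoly_permute:
  assumes "symmetric_mpoly n f" "\<sigma> \<in> carrier (sym_group (n + 1))"
  shows "eval_mpoly f (x \<circ> \<sigma>) = eval_mpoly f x"
proof -
  let ?p = "Poly_Mapping.map_key \<sigma> :: (nat \<Rightarrow>\<^sub>0 nat) \<Rightarrow> _"
  have bij: "bij \<sigma>" using assms(2) by (auto simp: sym_group_carrier intro: permutes_bij)
  then have inj: "inj \<sigma>" by (rule bij_is_inj)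
  have lookup_p: "Poly_Mapping.lookup (?p a) i = Poly_Mapping.lookup a (\<sigma> i)" for a i
    using inj by (simp add: map_key.rep_eq)
  have keys_p: "Poly_Mapping.keys (?p a) = \<sigma> -` Poly_Mapping.keys a" for a
    using inj by (rule keys_map_key)
  have inj_p: "inj ?p"
  proof (rule injI)
    fix a b assume ab: "?p a = ?p b"
    show "a = b"
    proof (rule poly_mapping_eqI)
      fix i
      obtain j where "i = \<sigma> j" using bij by (metis bij_pointE)
      then show "Poly_Mapping.lookup a i = Poly_Mapping.lookup b i"
        using lookup_p[of a j] lookup_p[of b j] ab by simp
    qed
  qed
  have f: "Poly_Mapping.map_key ?p f = f"
    using assms by (simp add: symmetric_mpoly_def permute_vars_def)
  have lookup_f: "Poly_Mapping.lookup f (?p a) = Poly_Mapping.lookup f a" for a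
    using inj_p by (metis f comp_apply map_key.rep_eq)
  have "?p ` Poly_Mapping.keys f \<subseteq> Poly_Mapping.keys f"
    by (auto simp: in_keys_iff lookup_f)
  then have img: "?p ` Poly_Mapping.keys f = Poly_Mapping.keys f"
    using inj_p by (intro endo_inj_surj) (auto intro: inj_on_subset)
  have prod: "(\<Prod>i\<in>Poly_Mapping.keys (?p a). (x \<circ> \<sigma>) i ^ Poly_Mapping.lookup (?p a) i) =
      (\<Prod>i\<in>Poly_Mapping.keys a. x i ^ Poly_Mapping.lookup a i)" for a
  proof -
    have "bij_betw \<sigma> (\<sigma> -` Poly_Mapping.keys a) (Poly_Mapping.keys a)"
      using bij by (auto simp: bij_betw_def surj_image_vimage_eq intro: inj_on_subset)
    from prod.reindex_bij_betw[OF this, of "\<lambda>i. x i ^ Poly_Mapping.lookup a i"]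
    show ?thesis by (simp add: keys_p lookup_p)
  qed
  have "eval_mpoly f (x \<circ> \<sigma>) = (\<Sum>a\<in>?p ` Poly_Mapping.keys f. Poly_Mapping.lookup f a *
      (\<Prod>i\<in>Poly_Mapping.keys a. (x \<circ> \<sigma>) i ^ Poly_Mapping.lookup a i))"
    unfolding img eval_mpoly_def ..
  also have "\<dots> = (\<Sum>a\<in>Poly_Mapping.keys f. Poly_Mapping.lookup f (?p a) *
      (\<Prod>i\<in>Poly_Mapping.keys (?p a). (x \<circ> \<sigma>) i ^ Poly_Mapping.lookup (?p a) i))"
    using inj_p by (subst sum.reindex) (auto intro: inj_on_subset)
  also have "\<dots> = eval_mpoly f x"
    unfolding prod lookup_f eval_mpoly_def ..
  finally show ?thesis .
qed

context form_family
begin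

lemma zeros_eq_zero_locus:
  assumes "\<And>i x. i \<in> {1..n} \<Longrightarrow> F i t x = eval_mpoly (f i) x"
  shows "zeros t = zero_locus n f"
  using assms by (auto simp: zeros_def zero_locus_def)

text \<open>For a representative \<open>y\<close> with \<open>y k = 1\<close> the chart Jacobian has
  determinant \<open>minor k t y\<close>, and homogeneity carries its nonvanishing to any other
  representative.\<close>

lemma transverse_nondegenerate:
  assumes F: "\<And>i x. i \<in> {1..n} \<Longrightarrow> F i t x = eval_mpoly (f i) x" and "transverse n f"
  shows "nondegenerate t"
  unfolding nondegenerate_def
proof (intro ballI impI)
  fix x assume x: "x \<in> hom_coords n" "is_zero t x"
  then have "line x \<in> zero_locus n f"
    using zeros_eq_zero_locus[OF F] line_in_zeros_iff by blast
  then obtain k y where k: "k \<in> {1..n+1}" and y: "y \<in> line x" "y k = 1"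
      and det: "Determinant.det (chart_jacobian n f k y) \<noteq> 0"
    using assms(2) unfolding transverse_def by blast
  have "chart_jacobian n f k y = Matrix.mat n n (\<lambda>(i, j).
     let l = insert_index k (j + 1) in deriv (\<lambda>s. F (i + 1) t (y(l := s))) (y l))"
    unfolding chart_jacobian_def
  proof (rule eq_matI, goal_cases)
    case (1 i j)
    let ?l = "insert_index k (j + 1)"
    \<comment> \<open>The differentiated coordinate is never the one set to \<open>1\<close>, so
      dehomogenizing does not alter the argument.\<close>
    have "?l \<noteq> k" by (simp add: insert_index_def)
    then have "(y(?l := s))(k := 1) = y(?l := s)" for s using y(2) by (auto simp: fun_eq_iff)
    then show ?case using 1 F[of "Suc i"] by (simp add: Let_def dehomogenize_def)
  qed auto
  then have "minor k t y \<noteq> 0" using det by (simp add: minor_def)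
  obtain c where c: "c \<noteq> 0" "y = (\<lambda>i. c * x i)" using y(1) by (auto simp: line_def)
  have "minor k t y = c ^ minor_degree * minor k t x"
    unfolding c(2) by (rule form_homogeneous[OF form_minor[OF k]])
  then show "\<exists>k\<in>{1..n+1}. x k \<noteq> 0 \<and> minor k t x \<noteq> 0"
    using \<open>minor k t y \<noteq> 0\<close> k y(2) c(2) by (intro bexI[of _ k]) auto
qed

section \<open>Zeros of the Fermat system\<close>

text \<open>Each equation makes \<open>x i\<close> vanish exactly when \<open>x (n + 1)\<close>
  does, so one vanishing coordinate would force all of them to vanish.\<close>

lemma fermat_nonzero:
  assumes F: "\<And>i x. i \<in> {1..n} \<Longrightarrow> F i t x = x i ^ d i - x (n + 1) ^ d i"
    and "x \<in> hom_coords n" "is_zero t x" "i \<in> {1..n+1}"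
  shows "x i \<noteq> 0"
proof -
  have eq: "x j ^ d j = x (n + 1) ^ d j" if "j \<in> {1..n}" for j
    using assms(3) F[OF that, of x] that by (simp add: is_zero_def)
  have z: "x j = 0 \<longleftrightarrow> x (n + 1) = 0" if "j \<in> {1..n}" for j
  proof -
    have "x j ^ d j = 0 \<longleftrightarrow> x (n + 1) ^ d j = 0" using eq[OF that] by simp
    then show ?thesis using degree_pos[OF that] by simp
  qed
  obtain j where j: "j \<in> {1..n+1}" "x j \<noteq> 0" using assms(2) by (auto simp: hom_coords_def)
  then have "x (n + 1) \<noteq> 0" using z[of j] by (cases "j = n + 1") auto
  then show ?thesis using z[of i] assms(4) by (cases "i = n + 1") auto
qed

text \<open>In the chart of the last coordinate the Jacobian is diagonal with entries
  \<open>d i * x i ^ (d i - 1)\<close>, none of which vanishes at a zero.\<close>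

lemma fermat_nondegenerate:
  assumes F: "\<And>i x. i \<in> {1..n} \<Longrightarrow> F i t x = x i ^ d i - x (n + 1) ^ d i"
  shows "nondegenerate t"
  unfolding nondegenerate_def
proof (intro ballI impI)
  fix x assume x: "x \<in> hom_coords n" "is_zero t x"
  define A where "A = Matrix.mat n n (\<lambda>(i, j).
     let l = insert_index (n + 1) (j + 1) in deriv (\<lambda>s. F (i + 1) t (x(l := s))) (x l))"
  have A: "A $$ (i, j) = (if i = j then of_nat (d (i + 1)) * x (i + 1) ^ (d (i + 1) - 1) else 0)"
    if "i < n" "j < n" for i j
  proof -
    have "A $$ (i, j) = deriv (\<lambda>s. F (i + 1) t (x(j + 1 := s))) (x (j + 1))"
      using that by (simp add: A_def insert_index_def)
    also have "(\<lambda>s. F (i + 1) t (x(j + 1 := s))) =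
        (\<lambda>s. (if i = j then s else x (i + 1)) ^ d (i + 1) - x (n + 1) ^ d (i + 1))"
      using F[of "i + 1"] that by auto
    also have "deriv \<dots> (x (j + 1)) =
        (if i = j then of_nat (d (i + 1)) * x (i + 1) ^ (d (i + 1) - 1) else 0)"
      by (rule DERIV_imp_deriv) (auto intro!: derivative_eq_intros)
    finally show ?thesis .
  qed
  have "A \<in> carrier_mat n n" by (simp add: A_def)
  then have "Determinant.det A = prod_list (diag_mat A)"
    by (intro det_upper_triangular) (auto simp: upper_triangular_def A)
  moreover have "\<forall>i<n. d (Suc i) \<noteq> 0 \<and> x (Suc i) \<noteq> 0"
  proof (intro allI impI)
    fix i assume "i < n"
    then show "d (Suc i) \<noteq> 0 \<and> x (Suc i) \<noteq> 0"
      using fermat_nonzero[OF F x, of "Suc i"] degree_pos[of "Suc i"] by auto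
  qed
  then have "prod_list (diag_mat A) \<noteq> 0"
    using \<open>A \<in> carrier_mat n n\<close> by (auto simp: prod_list_zero_iff diag_mat_def A)
  ultimately have "minor (n + 1) t x \<noteq> 0" by (simp add: minor_def A_def)
  then show "\<exists>k\<in>{1..n+1}. x k \<noteq> 0 \<and> minor k t x \<noteq> 0"
    using fermat_nonzero[OF F x, of "n + 1"] by (intro bexI[of _ "n + 1"]) auto
qed

text \<open>Scaling the last coordinate to \<open>1\<close> identifies the zeros with tuples of
  roots of unity of orders dividing \<open>d i\<close>, and there are \<open>d i\<close> choices in
  place \<open>i\<close>.\<close>

lemma card_fermat_zeros:
  assumes F: "\<And>i x. i \<in> {1..n} \<Longrightarrow> F i t x = x i ^ d i - x (n + 1) ^ d i"
  shows "card (zeros t) = (\<Prod>i\<in>{1..n}. d i)"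
proof -
  let ?R = "\<lambda>i. {z :: complex. z ^ d i = 1}"
  define pt where "pt = (\<lambda>u i. if i \<in> {1..n} then u i else if i = n + 1 then 1 else (0 :: complex))"
  have hom: "pt u \<in> hom_coords n" for u
    by (auto simp: pt_def hom_coords_def intro!: bexI[of _ "n + 1"])
  have zero: "is_zero t (pt u) \<longleftrightarrow> (\<forall>i\<in>{1..n}. u i ^ d i = 1)" for u
    by (auto simp: is_zero_def F pt_def)
  have "bij_betw (\<lambda>u. line (pt u)) (Pi\<^sub>E {1..n} ?R) (zeros t)"
    unfolding bij_betw_def
  proof
    show "inj_on (\<lambda>u. line (pt u)) (Pi\<^sub>E {1..n} ?R)"
    proof (rule inj_onI)
      fix u v assume uv: "u \<in> Pi\<^sub>E {1..n} ?R" "v \<in> Pi\<^sub>E {1..n} ?R" "line (pt u) = line (pt v)"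
      have "pt u \<in> line (pt v)" using line_self[of "pt u"] uv(3) by simp
      then obtain c where c: "pt u = (\<lambda>i. c * pt v i)" by (auto simp: line_def)
      have "c = 1" using fun_cong[OF c, of "n + 1"] by (simp add: pt_def)
      then have "u i = v i" if "i \<in> {1..n}" for i
        using fun_cong[OF c, of i] that by (simp add: pt_def)
      then show "u = v" using uv(1,2) by (intro PiE_ext) auto
    qed
    show "(\<lambda>u. line (pt u)) ` Pi\<^sub>E {1..n} ?R = zeros t"
    proof (intro equalityI subsetI)
      fix P assume "P \<in> (\<lambda>u. line (pt u)) ` Pi\<^sub>E {1..n} ?R"
      then show "P \<in> zeros t" using line_in_zeros_iff[OF hom] zero by (auto simp: PiE_iff)
    next
      fix P assume "P \<in> zeros t"
      then obtain x where x: "x \<in> max_sphere n" "is_zero t x" "P = line x" by (rule zerosE)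
      have xh: "x \<in> hom_coords n" using max_sphere_hom_coords[OF x(1)] .
      define c where "c = inverse (x (n + 1))"
      have nz: "x (n + 1) \<noteq> 0" using fermat_nonzero[OF F xh x(2), of "n + 1"] by simp
      then have c: "c \<noteq> 0" "c * x (n + 1) = 1" by (simp_all add: c_def)
      define u where "u = (\<lambda>i\<in>{1..n}. c * x i)"
      have pt: "pt u = (\<lambda>i. c * x i)"
        using xh c(2) by (auto simp: pt_def u_def hom_coords_def fun_eq_iff)
      then have pl: "pt u \<in> line x" using line_scale[OF line_self c(1)] by simp
      then have "\<forall>i\<in>{1..n}. u i ^ d i = 1" using is_zero_line[OF pl x(2)] zero by blast
      then have "u \<in> Pi\<^sub>E {1..n} ?R" by (auto simp: u_def)
      then show "P \<in> (\<lambda>u. line (pt u)) ` Pi\<^sub>E {1..n} ?R"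
        using line_eq[OF pl] x(3) by blast
    qed
  qed
  then have "card (zeros t) = card (Pi\<^sub>E {1..n} ?R)" by (simp add: bij_betw_same_card)
  also have "\<dots> = (\<Prod>i\<in>{1..n}. card (?R i))" by (simp add: card_PiE)
  also have "\<dots> = (\<Prod>i\<in>{1..n}. d i)"
    using degree_pos by (intro prod.cong card_roots_unity_eq) (auto simp: Suc_le_eq)
  finally show ?thesis .
qed

text \<open>Precomposition and inversion both reverse the order, so together they give a left
  action.\<close>

lemma act_comp:
  assumes "bij \<sigma>" "bij \<tau>"
  shows "act (\<sigma> \<circ> \<tau>) P = act \<sigma> (act \<tau> P)"
  using o_inv_distrib[OF assms] by (simp add: act_def image_comp comp_assoc o_def)

lemma act_group_action:
  assumes sym: "carrier (sym_group (n + 1)) \<subseteq> symmetries"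
  shows "group_action (sym_group (n + 1)) (zeros t) (perm_action (zeros t))"
proof -
  let ?G = "sym_group (n + 1)" and ?E = "zeros t"
  have pa: "perm_action ?E \<sigma> = restrict (act \<sigma>) ?E" for \<sigma>
    by (simp add: perm_action_def act_def[abs_def])
  have bij: "bij \<sigma>" if "\<sigma> \<in> carrier ?G" for \<sigma>
    using that by (auto simp: sym_group_carrier intro: permutes_bij)
  have mem: "act \<sigma> P \<in> ?E" if "\<sigma> \<in> carrier ?G" "P \<in> ?E" for \<sigma> P
    using act_zeros that sym by blast
  have inv_mem: "inv_into UNIV \<sigma> \<in> carrier ?G" if "\<sigma> \<in> carrier ?G" for \<sigma>
    using that by (auto simp: sym_group_carrier intro: permutes_inv)
  have id: "act id P = P" for P by (simp add: act_def)
  have Bij: "perm_action ?E \<sigma> \<in> Bij ?E" if "\<sigma> \<in> carrier ?G" for \<sigma>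
  proof -
    have "act \<sigma> (act (inv_into UNIV \<sigma>) P) = P" "act (inv_into UNIV \<sigma>) (act \<sigma> P) = P" for P
      using bij[OF that] bij[OF inv_mem[OF that]]
      by (simp_all add: act_comp[symmetric] id bij_is_surj surj_iff[THEN iffD1] bij_is_inj)
    then have "bij_betw (act \<sigma>) ?E ?E"
      using mem[OF that] mem[OF inv_mem[OF that]]
      by (intro bij_betw_byWitness[where f' = "act (inv_into UNIV \<sigma>)"]) auto
    then show ?thesis unfolding pa Bij_def by simp
  qed
  have "perm_action ?E \<in> hom ?G (BijGroup ?E)"
  proof (rule homI)
    fix \<sigma> assume "\<sigma> \<in> carrier ?G"
    then show "perm_action ?E \<sigma> \<in> carrier (BijGroup ?E)" using Bij by (simp add: BijGroup_def)
  next
    fix \<sigma> \<tau> assume st: "\<sigma> \<in> carrier ?G" "\<tau> \<in> carrier ?G"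
    have "perm_action ?E (\<sigma> \<circ> \<tau>) = compose ?E (perm_action ?E \<sigma>) (perm_action ?E \<tau>)"
      unfolding pa compose_def using mem[OF st(2)] act_comp[OF bij[OF st(1)] bij[OF st(2)]]
      by (auto simp: fun_eq_iff)
    then show "perm_action ?E (\<sigma> \<otimes>\<^bsub>?G\<^esub> \<tau>) =
        perm_action ?E \<sigma> \<otimes>\<^bsub>BijGroup ?E\<^esub> perm_action ?E \<tau>"
      using Bij st by (simp add: BijGroup_def sym_group_mult)
  qed
  then show ?thesis
    unfolding group_action_def group_hom_def group_hom_axioms_def
    using sym_group_is_group group_BijGroup by blast
qed

lemma equivalent_gset_isomorphic:
  assumes sym: "carrier (sym_group (n + 1)) \<subseteq> symmetries" and "equivalent t s"
  shows "gset_isomorphic (sym_group (n + 1))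
    (zeros t) (perm_action (zeros t)) (zeros s) (perm_action (zeros s))"
proof -
  obtain h where h: "bij_betw h (zeros t) (zeros s)"
      "\<And>\<sigma> P. \<sigma> \<in> symmetries \<Longrightarrow> P \<in> zeros t \<Longrightarrow> h (act \<sigma> P) = act \<sigma> (h P)"
    using assms(2) by (auto simp: equivalent_def)
  have "h (perm_action (zeros t) \<sigma> P) = perm_action (zeros s) \<sigma> (h P)"
    if "\<sigma> \<in> carrier (sym_group (n + 1))" "P \<in> zeros t" for \<sigma> P
    using h(2)[of \<sigma> P] sym that bij_betw_apply[OF h(1) that(2)]
    by (auto simp: perm_action_def act_def)
  then show ?thesis using h(1) unfolding gset_isomorphic_def by blast
qed

end

lemma form_pencil:
  assumes "form m d (\<lambda>t x. G x)" "form m d (\<lambda>t x. H x)"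
  shows "form m d (\<lambda>t x. (1 - t) * G x + t * H x)"
  using form_add[OF form_cmult[OF assms(1), of "[:1, -1:]"] form_cmult[OF assms(2), of "[:0, 1:]"]]
  by simp

theorem theorem2p4:
  fixes n :: nat and d :: "nat \<Rightarrow> nat" and f :: "nat \<Rightarrow> mpoly"
  assumes "n \<ge> 1"
    and "\<forall>i\<in>{1..n}. d i \<ge> 1"
    and "symmetric_forms n d f"
    and "transverse n f"
  shows "group_action (sym_group (n + 1)) (zero_locus n f) (perm_action (zero_locus n f)) \<and>
    finite (zero_locus n f) \<and>
    card (zero_locus n f) = (\<Prod>i\<in>{1..n}. d i) \<and>
    (\<forall>g. symmetric_forms n d g \<and> transverse n g \<longrightarrow>
      gset_isomorphic (sym_group (n + 1))
        (zero_locus n f) (perm_action (zero_locus n f))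
        (zero_locus n g) (perm_action (zero_locus n g)))"
proof -
  have form_eval: "form (n + 1) (d i) (\<lambda>t x. eval_mpoly (g i) x)"
    if "symmetric_forms n d g" "i \<in> {1..n}" for g i
    using that form_eval_mpoly by (simp add: symmetric_forms_def)
  have invariant: "eval_mpoly (g i) (x \<circ> inv_into UNIV \<sigma>) = eval_mpoly (g i) x"
    if "symmetric_forms n d g" "i \<in> {1..n}" "\<sigma> permutes {1..n+1}" for g i x \<sigma>
    using that eval_mpoly_permute[of n "g i" "inv_into UNIV \<sigma>"] permutes_inv
    by (auto simp: symmetric_forms_def sym_group_carrier)
  \<comment> \<open>This pencil ends at a system whose zeros can be counted. From its equivalence
    only the cardinality is kept.\<close>
  define H where "H = (\<lambda>i t x. (1 - t) * eval_mpoly (f i) x + t * (x i ^ d i - x (n + 1) ^ d i))"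
  interpret H: form_family n d H
  proof
    fix i assume i: "i \<in> {1..n}"
    have "form (n + 1) (d i * 1) (\<lambda>t x. x i ^ d i - x (n + 1) ^ d i)"
      using i by (intro form_diff form_power form_var) auto
    then show "form (n + 1) (d i) (H i)"
      unfolding H_def using form_pencil[OF form_eval[OF assms(3) i]] by simp
  qed (use assms(2) in auto)
  have H0: "H i 0 x = eval_mpoly (f i) x" for i x by (simp add: H_def)
  have H1: "H i 1 x = x i ^ d i - x (n + 1) ^ d i" for i x by (simp add: H_def)
  have nd: "H.nondegenerate 0" by (rule H.transverse_nondegenerate[OF H0 assms(4)])
  have zl: "H.zeros 0 = zero_locus n f" by (rule H.zeros_eq_zero_locus[OF H0])
  have "H.equivalent 0 1"
    by (rule H.nondegenerate_equivalent[OF nd H.fermat_nondegenerate[OF H1]])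
  then have "card (H.zeros 0) = card (H.zeros 1)"
    unfolding H.equivalent_def by (blast dest: bij_betw_same_card)
  then have card: "card (zero_locus n f) = (\<Prod>i\<in>{1..n}. d i)"
    using zl H.card_fermat_zeros[OF H1] by simp
  have fin: "finite (zero_locus n f)" using H.finite_zeros[OF nd] zl by simp
  \<comment> \<open>The group action is established here because it requires the whole symmetric
    group among the symmetries, which the pencil \<open>K\<close> of two symmetric systems
    provides.\<close>
  have pencil: "group_action (sym_group (n + 1)) (zero_locus n f) (perm_action (zero_locus n f)) \<and>
      gset_isomorphic (sym_group (n + 1))
        (zero_locus n f) (perm_action (zero_locus n f))
        (zero_locus n g) (perm_action (zero_locus n g))"
    if g: "symmetric_forms n d g" "transverse n g" for g
  proof -
    define K where "K = (\<lambda>i t x. (1 - t) * eval_mpoly (f i) x + t * eval_mpoly (g i) x)"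
    interpret K: form_family n d K
    proof
      show "form (n + 1) (d i) (K i)" if "i \<in> {1..n}" for i
        unfolding K_def by (rule form_pencil[OF form_eval[OF assms(3) that] form_eval[OF g(1) that]])
    qed (use assms(2) in auto)
    have K0: "K i 0 x = eval_mpoly (f i) x" and K1: "K i 1 x = eval_mpoly (g i) x" for i x
      by (simp_all add: K_def)
    have sym: "carrier (sym_group (n + 1)) \<subseteq> K.symmetries"
    proof
      fix \<sigma> assume "\<sigma> \<in> carrier (sym_group (n + 1))"
      then have \<sigma>: "\<sigma> permutes {1..n+1}" by (simp add: sym_group_carrier)
      have "K i t (x \<circ> inv_into UNIV \<sigma>) = K i t x" if "i \<in> {1..n}" for i t x
        unfolding K_def using invariant[OF assms(3) that \<sigma>] invariant[OF g(1) that \<sigma>] by simp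
      then show "\<sigma> \<in> K.symmetries" using \<sigma> by (simp add: K.symmetries_def)
    qed
    have "K.equivalent 0 1"
      by (rule K.nondegenerate_equivalent[OF K.transverse_nondegenerate[OF K0 assms(4)]
            K.transverse_nondegenerate[OF K1 g(2)]])
    then show ?thesis
      using K.act_group_action[OF sym, of 0] K.equivalent_gset_isomorphic[OF sym]
        K.zeros_eq_zero_locus[OF K0] K.zeros_eq_zero_locus[OF K1] by metis
  qed
  \<comment> \<open>Taking \<open>g = f\<close> supplies the group action on the zero locus without
    reference to a second system.\<close>
  show ?thesis using pencil[OF assms(3,4)] pencil fin card by blast
qed

end
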